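(* Let $T>0$, let $m,n\ge1$ be integers, and let $Q,S,N\in O(m)$ satisfy $S^n=Q$, $N^2=I_m$, $SN=NS^{\mathsf T}$. Let $L\in C^2(\mathbb R\times\mathbb R^m\times\mathbb R^m,\mathbb R)$ satisfy the Legendre convexity condition and $$L(t,x,v)=L(t-T/n,Sx,Sv),\qquad L(t,x,v)=L(T/n-t,Nx,-Nv)\qquad\text{for all }t,x,v.$$ Let $x\in E_{\mathbb R}$ be a $D_n$-equivariant critical point of the Lagrangian action $\int_0^TL(t,x,\dot x)\,dt$ on $E_{\mathbb R}$, let $\mathcal I$ be its index form on $E=E_{\mathbb R}\otimes\mathbb C$, and let $\mathrm n_-(x)=\mathrm n_-(\mathcal I)$ be its Morse index. Then for every $h=0,\dots,n-1$ $$\mathrm n_-(x)=\mathrm n_-(\mathcal I|_{E_h^+})+\mathrm n_-(\mathcal I|_{E_h^-}),$$ and, for each choice of sign, $$\mathrm n_-(\mathcal I|_{E_h^\pm})=\sum_{k=0}^{\bar n}\mathrm n_-(\mathcal I|_{F_{k,h}^\pm}).$$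
   Context: $E_{\mathbb R}$ is the Hilbert space of $W^{1,2}_{\mathrm{loc}}$ functions $x:\mathbb R\to\mathbb R^m$ with $x(t)=Qx(t+T)$ for all $t$, with the $W^{1,2}([0,T])$ norm; $E=E_{\mathbb R}\otimes\mathbb C$. Legendre convexity: $\langle D^2_{vv}L(t,q,v)w,w\rangle>0$ for all $t,q,v$ and $w\in\mathbb R^m\setminus\{0\}$. Critical points of the action on $E_{\mathbb R}$ are the classical solutions of the Euler–Lagrange equation $\frac{d}{dt}\partial_vL(t,x,\dot x)-\partial_xL(t,x,\dot x)=0$ with $x(0)=Qx(T)$, $\dot x(0)=Q\dot x(T)$. $D_n$ acts on $E_{\mathbb R}$ and $E$ through $(\mathcal Su)(t)=Su(t+T/n)$ and $(\mathcal Nu)(t)=Nu(T/n-t)$; $x$ is $D_n$-equivariant if $\mathcal Sx=x$ and $\mathcal Nx=x$. Index form: $\mathcal I(u,v)=\int_0^T\{\langle P\dot u+\mathbf Qu,\dot v\rangle+\langle\mathbf Q^{\mathsf T}\dot u,v\rangle+\langle Ru,v\rangle\}dt$ for $u,v\in E$, with the standard Hermitian product, where, along $(t,x(t),\dot x(t))$, $P=\partial^2L/\partial v^2$, $\mathbf Q=\big(\partial^2L/\partial v_i\partial x_j\big)_{ij}$, $R=\partial^2L/\partial x^2$. The Morse index $\mathrm n_-$ of a Hermitian form on a space is the maximal dimension of a subspace on which it is negative definite. Subspaces: $\zeta_n=e^{2\pi i/n}$, $\bar n=\lfloor n/2\rfloor$, $E_k=\{u\in E:\mathcal Su=\zeta_n^ku\}$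 for $k\in\mathbb Z$; $F_0=E_0$, $F_k=E_k\oplus E_{-k}$ for $1\le k\le\lfloor(n-1)/2\rfloor$, and $F_{n/2}=E_{n/2}$ if $n$ is even. For $h=0,\dots,n-1$: $E_h^\pm=\{u\in E:\mathcal N\mathcal S^hu=\pm u\}$ and $F_{k,h}^\pm=\{u\in F_k:\mathcal N\mathcal S^hu=\pm u\}$. *)

theory Defs
  imports "HOL-Analysis.Analysis" "HOL-Library.Function_Algebras" "HOL-Library.Extended_Nat"
begin

section \<open>Matrices and twisted shifts\<close>

(* "^" on square matrices is the componentwise power, so matrix powers are iterated "**". *)
definition mat_pow :: "'a::semiring_1^'m^'m \<Rightarrow> nat \<Rightarrow> 'a^'m^'m" where
  "mat_pow A k = (((**) A) ^^ k) (mat 1)"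

definition cmat :: "real^'m^'m \<Rightarrow> complex^'m^'m" where
  "cmat A = map_matrix complex_of_real A"

(* The generators of the dihedral group act by the same formulas on real loops and on
   complex ones; on complex loops the matrix argument is cmat S or cmat N. *)
definition actS :: "real \<Rightarrow> nat \<Rightarrow> 'a::semiring_1^'m^'m \<Rightarrow> (real \<Rightarrow> 'a^'m) \<Rightarrow> (real \<Rightarrow> 'a^'m)" where
  "actS T n S u = (\<lambda>t. S *v u (t + T / real n))"

definition actN :: "real \<Rightarrow> nat \<Rightarrow> 'a::semiring_1^'m^'m \<Rightarrow> (real \<Rightarrow> 'a^'m) \<Rightarrow> (real \<Rightarrow> 'a^'m)" where
  "actN T n N u = (\<lambda>t. N *v u (T / real n - t))"

section \<open>The spaces\<close>

(* Elements of W^{1,2}_loc are represented by their continuous representatives: u is a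
   primitive of a locally square integrable g, which is then its weak derivative. *)
definition has_weak_deriv ::
    "(real \<Rightarrow> 'a::euclidean_space) \<Rightarrow> (real \<Rightarrow> 'a) \<Rightarrow> bool" where
  "has_weak_deriv u g \<longleftrightarrow>
     g \<in> borel_measurable borel \<and>
     (\<forall>a b. set_integrable lborel {a..b} (\<lambda>t. (norm (g t))\<^sup>2)) \<and>
     (\<forall>a b. a \<le> b \<longrightarrow> u b - u a = (LBINT t:{a..b}. g t))"

definition W12_loc :: "(real \<Rightarrow> 'a::euclidean_space) set" where
  "W12_loc = {u. \<exists>g. has_weak_deriv u g}"

(* Unique up to null sets, hence irrelevant under the integral of the index form. *)
definition weak_deriv :: "(real \<Rightarrow> 'a::euclidean_space) \<Rightarrow> (real \<Rightarrow> 'a)" where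
  "weak_deriv u = (SOME g. has_weak_deriv u g)"

definition E_real :: "real \<Rightarrow> real^'m^'m \<Rightarrow> (real \<Rightarrow> real^'m) set" where
  "E_real T Q = {x \<in> W12_loc. \<forall>t. x t = Q *v x (t + T)}"

(* Complexification of E_real, with a + i b realised as a complex-vector-valued function. *)
definition E_cplx :: "real \<Rightarrow> real^'m^'m \<Rightarrow> (real \<Rightarrow> complex^'m) set" where
  "E_cplx T Q = {u. (\<lambda>t. \<chi> i. Re (u t $ i)) \<in> E_real T Q \<and>
                    (\<lambda>t. \<chi> i. Im (u t $ i)) \<in> E_real T Q}"

definition equivariant ::
    "real \<Rightarrow> nat \<Rightarrow> real^'m^'m \<Rightarrow> real^'m^'m \<Rightarrow> (real \<Rightarrow> real^'m) \<Rightarrow> bool" where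
  "equivariant T n S N x \<longleftrightarrow> actS T n S x = x \<and> actN T n N x = x"

definition cscale :: "complex \<Rightarrow> (real \<Rightarrow> complex^'m) \<Rightarrow> (real \<Rightarrow> complex^'m)" where
  "cscale c u = (\<lambda>t. c *s u t)"

global_interpretation cfun: vector_space "cscale :: complex \<Rightarrow> (real \<Rightarrow> complex^'m) \<Rightarrow> _"
  by unfold_locales
    (auto simp: cscale_def fun_eq_iff vec_eq_iff algebra_simps)

definition zeta :: "nat \<Rightarrow> complex" where
  "zeta n = exp (2 * of_real pi * \<i> / of_nat n)"

definition E_eig :: "real \<Rightarrow> nat \<Rightarrow> real^'m^'m \<Rightarrow> real^'m^'m \<Rightarrow> int \<Rightarrow> (real \<Rightarrow> complex^'m) set" where
  "E_eig T n Q S k = {u \<in> E_cplx T Q. actS T n (cmat S) u = cscale (zeta n powi k) u}"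

(* Meaningful for k \<le> n div 2; the last case is then 1 \<le> k \<le> (n - 1) div 2, where the sum is direct. *)
definition F_sp :: "real \<Rightarrow> nat \<Rightarrow> real^'m^'m \<Rightarrow> real^'m^'m \<Rightarrow> nat \<Rightarrow> (real \<Rightarrow> complex^'m) set" where
  "F_sp T n Q S k =
     (if k = 0 then E_eig T n Q S 0
      else if 2 * k = n then E_eig T n Q S (int k)
      else {u + v | u v. u \<in> E_eig T n Q S (int k) \<and> v \<in> E_eig T n Q S (- int k)})"

(* The sign is passed as s = 1 or s = -1. *)
definition E_refl ::
    "real \<Rightarrow> nat \<Rightarrow> real^'m^'m \<Rightarrow> real^'m^'m \<Rightarrow> real^'m^'m \<Rightarrow> nat \<Rightarrow> complex
      \<Rightarrow> (real \<Rightarrow> complex^'m) set" where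
  "E_refl T n Q S N h s =
     {u \<in> E_cplx T Q. actN T n (cmat N) ((actS T n (cmat S) ^^ h) u) = cscale s u}"

definition F_refl ::
    "real \<Rightarrow> nat \<Rightarrow> real^'m^'m \<Rightarrow> real^'m^'m \<Rightarrow> real^'m^'m \<Rightarrow> nat \<Rightarrow> nat \<Rightarrow> complex
      \<Rightarrow> (real \<Rightarrow> complex^'m) set" where
  "F_refl T n Q S N k h s =
     {u \<in> F_sp T n Q S k. actN T n (cmat N) ((actS T n (cmat S) ^^ h) u) = cscale s u}"

section \<open>The Lagrangian\<close>

definition C2 :: "('a::real_normed_vector \<Rightarrow> 'b::real_normed_vector) \<Rightarrow> bool" where
  "C2 f \<longleftrightarrow>
     (\<exists>(f' :: 'a \<Rightarrow> 'a \<Rightarrow>\<^sub>L 'b) (f'' :: 'a \<Rightarrow> 'a \<Rightarrow>\<^sub>L ('a \<Rightarrow>\<^sub>L 'b)).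
        (\<forall>p. (f has_derivative blinfun_apply (f' p)) (at p)) \<and>
        (\<forall>p. (f' has_derivative blinfun_apply (f'' p)) (at p)) \<and>
        continuous_on UNIV f'')"

definition partial :: "'m \<Rightarrow> (real^'m \<Rightarrow> real) \<Rightarrow> real^'m \<Rightarrow> real" where
  "partial i f q = frechet_derivative f (at q) (axis i 1)"

context
  fixes L :: "real \<Rightarrow> real^'m \<Rightarrow> real^'m \<Rightarrow> real"
begin

definition grad_x :: "real \<Rightarrow> real^'m \<Rightarrow> real^'m \<Rightarrow> real^'m" where
  "grad_x t q v = (\<chi> i. partial i (\<lambda>y. L t y v) q)"

definition grad_v :: "real \<Rightarrow> real^'m \<Rightarrow> real^'m \<Rightarrow> real^'m" where
  "grad_v t q v = (\<chi> i. partial i (\<lambda>w. L t q w) v)"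

definition hess_vv :: "real \<Rightarrow> real^'m \<Rightarrow> real^'m \<Rightarrow> real^'m^'m" where
  "hess_vv t q v = (\<chi> i j. partial i (\<lambda>w. partial j (\<lambda>z. L t q z) w) v)"

definition hess_vx :: "real \<Rightarrow> real^'m \<Rightarrow> real^'m \<Rightarrow> real^'m^'m" where
  "hess_vx t q v = (\<chi> i j. partial i (\<lambda>w. partial j (\<lambda>y. L t y w) q) v)"

definition hess_xx :: "real \<Rightarrow> real^'m \<Rightarrow> real^'m \<Rightarrow> real^'m^'m" where
  "hess_xx t q v = (\<chi> i j. partial i (\<lambda>y. partial j (\<lambda>z. L t z v) y) q)"

definition legendre_convex :: bool where
  "legendre_convex \<longleftrightarrow> (\<forall>t q v w. w \<noteq> 0 \<longrightarrow> (hess_vv t q v *v w) \<bullet> w > 0)"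

(* Critical points of the action on E_real, i.e. the classical solutions of the
   Euler-Lagrange equation. No growth condition is imposed on L, so the action itself need
   not be finite or differentiable on all of E_real. The boundary conditions are listed
   although they follow from x t = Q x(t + T). *)
definition critical_point :: "real \<Rightarrow> real^'m^'m \<Rightarrow> (real \<Rightarrow> real^'m) \<Rightarrow> bool" where
  "critical_point T Q x \<longleftrightarrow>
     x \<in> E_real T Q \<and> x C1_differentiable_on UNIV \<and>
     (let x' = (\<lambda>t. vector_derivative x (at t)) in
       (\<forall>t. ((\<lambda>s. grad_v s (x s) (x' s)) has_vector_derivative grad_x t (x t) (x' t)) (at t)) \<and>
       x 0 = Q *v x T \<and> x' 0 = Q *v x' T)"

section \<open>Index form and Morse index\<close>

definition herm :: "complex^'m \<Rightarrow> complex^'m \<Rightarrow> complex" where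
  "herm a b = (\<Sum>i\<in>UNIV. a $ i * cnj (b $ i))"

definition index_form ::
    "real \<Rightarrow> (real \<Rightarrow> real^'m) \<Rightarrow> (real \<Rightarrow> complex^'m) \<Rightarrow> (real \<Rightarrow> complex^'m) \<Rightarrow> complex" where
  "index_form T x u v =
     (let x' = (\<lambda>t. vector_derivative x (at t));
          P = (\<lambda>t. cmat (hess_vv t (x t) (x' t)));
          B = (\<lambda>t. cmat (hess_vx t (x t) (x' t)));
          R = (\<lambda>t. cmat (hess_xx t (x t) (x' t)));
          u' = weak_deriv u;
          v' = weak_deriv v
      in LBINT t:{0..T}.
           herm (P t *v u' t + B t *v u t) (v' t)
           + herm (transpose (B t) *v u' t) (v t)
           + herm (R t *v u t) (v t))"

end

(* For a Hermitian form B the value B w w is real, so taking Re loses nothing. *)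
definition negative_definite_on ::
    "((real \<Rightarrow> complex^'m) \<Rightarrow> (real \<Rightarrow> complex^'m) \<Rightarrow> complex) \<Rightarrow> (real \<Rightarrow> complex^'m) set \<Rightarrow> bool" where
  "negative_definite_on B W \<longleftrightarrow> (\<forall>w\<in>W. w \<noteq> 0 \<longrightarrow> Re (B w w) < 0)"

(* Complex dimension of a maximal negative subspace of V, with value \<infinity> if unbounded.
   cfun.dim is 0 on an infinite-dimensional W, which is harmless: W has subspaces of every
   finite dimension, and these are negative too. *)
definition morse_index ::
    "((real \<Rightarrow> complex^'m) \<Rightarrow> (real \<Rightarrow> complex^'m) \<Rightarrow> complex) \<Rightarrow> (real \<Rightarrow> complex^'m) set \<Rightarrow> enat" where
  "morse_index B V =
     (SUP W\<in>{W. cfun.subspace W \<and> W \<subseteq> V \<and> negative_definite_on B W}. enat (cfun.dim W))"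

end

theory Submission
  imports Defs
begin

text \<open>
  The two maps \<S> and \<N> generate an action of the dihedral group on the space E of complex loops, and
  the index form is invariant under it. Everything follows from this.

  Invariance makes subspaces orthogonal: if an isometry multiplies u by a and v by b, where a and b
  are distinct numbers of modulus 1, then the form vanishes on the pair. Hence the two eigenspaces of
  the involution \<N> \<S>^h are orthogonal, and so are the eigenspaces of \<S> for distinct powers of
  \<zeta>, and their pairings F_k. The involution exchanges the eigenspaces of k and -k, so it acts on F_k,
  and the eigencomponents of an element of E_h, symmetrised with respect to the involution, lie in
  the spaces F_{k,h} (refl_eig_eq_span_isotypic).

  The Morse index is additive on orthogonal sums (morse_index_orthogonal_sum). This is Sylvester's law
  of inertia: if the index of a summand is finite, a negative definite subspace of maximal dimension
  has a complement on which the form is nonnegative; the sum of such subspaces has such a complement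
  as well, and every negative definite subspace projects injectively along it
  (morse_index_eq_card).

  Analysis is needed for the invariance of the form (form_twist). The maps \<S>, \<N> and the shift by T
  with the matrix Q are instances of one operation, a change of time t \<mapsto> c + e t with
  e = 1 or e = -1 combined with a matrix A. The Lagrangian and the path x have the corresponding
  symmetry, so differentiating L twice shows that the coefficients of the index form at the times t and
  c + e t are congruent by A (twist_covariant_along). The integrand of the form at the transformed
  loops is then the original integrand at the transformed time, and it is T-periodic, so that the
  integral over a period is unchanged. Weak derivatives are determined only up to null sets
  (has_weak_deriv_unique), which does not affect the integrals.
\<close>

section \<open>The Morse index of an orthogonal sum\<close>

text \<open>Loops are functions, and vectors of the space of loops. Evaluating sums of loops pointwise would
  take the simplifier out of that vector space, so it is done only where it is asked for.\<close>

declare plus_fun_apply [simp del] zero_fun_apply [simp del] minus_apply [simp del]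


text \<open>If a vector of C lay in the span of the others, the part of the combination that comes from D
  would lie in both spans, hence vanish, and C itself would be dependent.\<close>

lemma independent_Un_if_spans_meet_trivially:
  fixes C D :: "(real \<Rightarrow> complex^'m) set"
  assumes C: "cfun.independent C" and D: "cfun.independent D"
    and inter: "cfun.span C \<inter> cfun.span D \<subseteq> {0}"
  shows "cfun.independent (C \<union> D)"
proof -
  have key: "x \<notin> cfun.span (C \<union> D - {x})"
    if C: "cfun.independent C" and inter: "cfun.span C \<inter> cfun.span D \<subseteq> {0}" and x: "x \<in> C"
    for x and C D :: "(real \<Rightarrow> complex^'m) set"
  proof
    assume "x \<in> cfun.span (C \<union> D - {x})"
    then have "x \<in> cfun.span ((C - {x}) \<union> (D - {x}))" by (simp add: Un_Diff)
    then obtain u v where uv: "x = u + v" "u \<in> cfun.span (C - {x})" "v \<in> cfun.span (D - {x})"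
      unfolding cfun.span_Un by blast
    have "u \<in> cfun.span C" "v \<in> cfun.span D"
      using uv cfun.span_mono[of "C - {x}" C] cfun.span_mono[of "D - {x}" D] by auto
    moreover have "v = x - u" using uv(1) by simp
    ultimately have "v \<in> cfun.span C \<inter> cfun.span D"
      using cfun.span_diff[OF cfun.span_base[OF x]] by auto
    then have "v = 0" using inter by blast
    then have "x \<in> cfun.span (C - {x})" using uv by simp
    then show False using C x by (auto simp: cfun.dependent_def)
  qed
  show ?thesis
    unfolding cfun.dependent_def using key[OF C inter] key[of D C] D inter
    by (auto simp: Un_commute Int_commute)
qed

text \<open>The Morse index sees only the real part of the quadratic form, which the form shares, up to the
  factor 2, with its Hermitian part. Orthogonal complements are taken for the latter, where orthogonality
  is a symmetric relation.\<close>

locale sesquilinear_form =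
  fixes B :: "(real \<Rightarrow> complex^'m) \<Rightarrow> (real \<Rightarrow> complex^'m) \<Rightarrow> complex"
    and E :: "(real \<Rightarrow> complex^'m) set"
  assumes subspace_E: "cfun.subspace E"
    and add_left: "u \<in> E \<Longrightarrow> v \<in> E \<Longrightarrow> w \<in> E \<Longrightarrow> B (u + v) w = B u w + B v w"
    and add_right: "u \<in> E \<Longrightarrow> v \<in> E \<Longrightarrow> w \<in> E \<Longrightarrow> B w (u + v) = B w u + B w v"
    and scale_left: "u \<in> E \<Longrightarrow> w \<in> E \<Longrightarrow> B (cscale c u) w = c * B u w"
    and scale_right: "u \<in> E \<Longrightarrow> w \<in> E \<Longrightarrow> B w (cscale c u) = cnj c * B w u"
begin

definition herm_part :: "(real \<Rightarrow> complex^'m) \<Rightarrow> (real \<Rightarrow> complex^'m) \<Rightarrow> complex" where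
  "herm_part u v = B u v + cnj (B v u)"

lemma herm_part_commute: "herm_part v u = cnj (herm_part u v)"
  by (simp add: herm_part_def)

lemma Re_herm_part_self: "Re (herm_part u u) = 2 * Re (B u u)"
  by (simp add: herm_part_def)

lemma herm_part_self_eq_of_real: "herm_part u u = of_real (2 * Re (B u u))"
  by (simp add: herm_part_def complex_eq_iff)

lemma herm_part_add_left:
  "u \<in> E \<Longrightarrow> v \<in> E \<Longrightarrow> w \<in> E \<Longrightarrow> herm_part (u + v) w = herm_part u w + herm_part v w"
  by (simp add: herm_part_def add_left add_right)

lemma herm_part_add_right:
  "u \<in> E \<Longrightarrow> v \<in> E \<Longrightarrow> w \<in> E \<Longrightarrow> herm_part w (u + v) = herm_part w u + herm_part w v"
  by (simp add: herm_part_def add_left add_right)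

lemma herm_part_scale_left:
  "u \<in> E \<Longrightarrow> w \<in> E \<Longrightarrow> herm_part (cscale c u) w = c * herm_part u w"
  by (simp add: herm_part_def scale_left scale_right algebra_simps)

lemma herm_part_scale_right:
  "u \<in> E \<Longrightarrow> w \<in> E \<Longrightarrow> herm_part w (cscale c u) = cnj c * herm_part w u"
  by (simp add: herm_part_def scale_left scale_right algebra_simps)

lemma herm_part_diff_left:
  assumes "u \<in> E" "v \<in> E" "w \<in> E"
  shows "herm_part (u - v) w = herm_part u w - herm_part v w"
proof -
  have "u - v \<in> E" using assms subspace_E by (simp add: cfun.subspace_diff)
  from herm_part_add_left[OF this assms(2,3)] show ?thesis by simp
qed

lemma herm_part_zero_left: "w \<in> E \<Longrightarrow> herm_part 0 w = 0"
  using herm_part_diff_left[of w w w] by simp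

lemma span_subset_E: "C \<subseteq> E \<Longrightarrow> cfun.span C \<subseteq> E"
  by (simp add: cfun.span_minimal subspace_E)

definition perp :: "(real \<Rightarrow> complex^'m) set \<Rightarrow> (real \<Rightarrow> complex^'m) set" where
  "perp W = {v \<in> E. \<forall>w\<in>W. herm_part v w = 0}"

lemma subspace_perp:
  assumes "W \<subseteq> E"
  shows "cfun.subspace (perp W)"
  using assms subspace_E unfolding cfun.subspace_def perp_def
  by (auto simp: herm_part_add_left herm_part_scale_left herm_part_zero_left subset_iff)

text \<open>Gram--Schmidt, one spanning vector at a time: the projection onto the span of C is corrected by a
  multiple of the component d of the new vector b that is orthogonal to C. Negative definiteness
  makes the pairing of d with itself nonzero, unless d = 0 and no correction is needed.\<close>

lemma orthogonal_projection_exists: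
  assumes "finite C" "C \<subseteq> E" "negative_definite_on B (cfun.span C)" "v \<in> E"
  shows "\<exists>a\<in>cfun.span C. v - a \<in> perp (cfun.span C)"
  using assms
proof (induction C arbitrary: v rule: finite_induct)
  case empty
  then show ?case by (simp add: perp_def herm_part_commute[of v] herm_part_zero_left)
next
  case (insert b C)
  have sub: "cfun.span C \<subseteq> cfun.span (insert b C)" by (simp add: cfun.span_mono subset_insertI)
  have CE: "cfun.span (insert b C) \<subseteq> E" using insert.prems span_subset_E by blast
  have neg: "negative_definite_on B (cfun.span C)"
    using insert.prems(2) sub by (auto simp: negative_definite_on_def)
  obtain c where c: "c \<in> cfun.span C" "b - c \<in> perp (cfun.span C)"
    using insert.IH[OF _ neg, of b] insert.prems by blast
  obtain a where a: "a \<in> cfun.span C" "v - a \<in> perp (cfun.span C)"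
    using insert.IH[OF _ neg, of v] insert.prems by blast
  define d where "d = b - c"
  have d_span: "d \<in> cfun.span (insert b C)"
    unfolding d_def using c sub cfun.span_base[of b "insert b C"] by (intro cfun.span_diff) auto
  have dE: "d \<in> E" using d_span CE by auto
  have vaE: "v - a \<in> E" using a by (simp add: perp_def)
  define l where "l = herm_part (v - a) d / herm_part d d"
  define a' where "a' = a + cscale l d"
  have "a' \<in> cfun.span (insert b C)"
    unfolding a'_def using a sub d_span by (intro cfun.span_add cfun.span_scale) auto
  moreover have "v - a' \<in> perp (cfun.span (insert b C))"
  proof -
    have eq: "v - a' = (v - a) - cscale l d" by (simp add: a'_def)
    have ldE: "cscale l d \<in> E" using dE subspace_E by (simp add: cfun.subspace_scale)
    have E': "v - a' \<in> E" unfolding eq using vaE ldE subspace_E by (simp add: cfun.subspace_diff)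
    have perpd: "herm_part (v - a') d = 0"
    proof (cases "d = 0")
      case True
      then show ?thesis using herm_part_commute[of "v - a'" 0] herm_part_zero_left[OF E'] 
        by (metis complex_cnj_zero herm_part_commute)
    next
      case False
      then have "Re (B d d) < 0" using insert.prems(2) d_span by (auto simp: negative_definite_on_def)
      then have "herm_part d d \<noteq> 0" by (simp add: herm_part_self_eq_of_real)
      then show ?thesis unfolding eq
        using herm_part_diff_left[OF vaE ldE dE] herm_part_scale_left[OF dE dE, of l]
        by (simp add: l_def)
    qed
    have perpC: "herm_part (v - a') w = 0" if w: "w \<in> cfun.span C" for w
    proof -
      have wE: "w \<in> E" using w sub CE by auto
      have "herm_part (v - a) w = 0" "herm_part d w = 0"
        using a c w by (auto simp: perp_def d_def)
      then show ?thesis unfolding eq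
        using herm_part_diff_left[OF vaE ldE wE] herm_part_scale_left[OF dE wE, of l] by simp
    qed
    have "herm_part (v - a') w = 0" if w: "w \<in> cfun.span (insert b C)" for w
    proof -
      obtain k where k: "w - cscale k b \<in> cfun.span C"
        using w by (auto simp: cfun.span_insert)
      define z where "z = w - cscale k b + cscale k c"
      have z: "z \<in> cfun.span C" unfolding z_def using k c by (intro cfun.span_add cfun.span_scale) auto
      have "w = z + cscale k d" by (simp add: z_def d_def cfun.scale_right_diff_distrib)
      moreover have "z \<in> E" using z sub CE by auto
      moreover have "cscale k d \<in> E" using dE subspace_E by (simp add: cfun.subspace_scale)
      ultimately show ?thesis
        using herm_part_add_right[of z "cscale k d" "v - a'"] herm_part_scale_right[OF dE E', of k]
          perpd perpC[OF z] E' by simp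
    qed
    then show ?thesis using E' by (simp add: perp_def)
  qed
  ultimately show ?case by blast
qed

text \<open>A witness for a lower bound of the Morse index. Working with finite bases instead of subspaces
  avoids the convention that infinite-dimensional spaces have dimension 0.\<close>

definition negative_basis :: "(real \<Rightarrow> complex^'m) set \<Rightarrow> (real \<Rightarrow> complex^'m) set \<Rightarrow> bool" where
  "negative_basis C V \<longleftrightarrow> finite C \<and> cfun.independent C \<and> cfun.span C \<subseteq> V
     \<and> negative_definite_on B (cfun.span C)"

lemma morse_index_eq_SUP_card:
  "morse_index B V = (SUP C\<in>{C. negative_basis C V}. enat (card C))"
  if "cfun.subspace V"
proof (rule antisym)
  show "morse_index B V \<le> (SUP C\<in>{C. negative_basis C V}. enat (card C))"
    unfolding morse_index_def
  proof (rule SUP_least)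
    fix W assume "W \<in> {W. cfun.subspace W \<and> W \<subseteq> V \<and> negative_definite_on B W}"
    then have W: "cfun.subspace W" "W \<subseteq> V" "negative_definite_on B W" by auto
    obtain C where C: "C \<subseteq> W" "cfun.independent C" "W \<subseteq> cfun.span C" "card C = cfun.dim W"
      using cfun.basis_exists by blast
    have span: "cfun.span C = W"
      using C W by (metis cfun.span_minimal subset_antisym)
    show "enat (cfun.dim W) \<le> (SUP C\<in>{C. negative_basis C V}. enat (card C))"
    proof (cases "finite C")
      case True
      then have "negative_basis C V" using C W span by (simp add: negative_basis_def)
      then show ?thesis using C(4) by (intro SUP_upper2[of C]) auto
    next
      case False
      then have "cfun.dim W = 0" using C(4) by simp
      then show ?thesis by (simp add: zero_enat_def[symmetric])
    qed
  qed
  show "(SUP C\<in>{C. negative_basis C V}. enat (card C)) \<le> morse_index B V"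
  proof (rule SUP_least)
    fix C assume "C \<in> {C. negative_basis C V}"
    then have C: "negative_basis C V" by simp
    then have "cfun.dim (cfun.span C) = card C"
      unfolding negative_basis_def by (intro cfun.dim_span_eq_card_independent) auto
    then show "enat (card C) \<le> morse_index B V"
      unfolding morse_index_def using C
      by (intro SUP_upper2[of "cfun.span C"]) (auto simp: negative_basis_def)
  qed
qed

lemma card_negative_basis_le:
  assumes "cfun.subspace V" "negative_basis C V"
  shows "enat (card C) \<le> morse_index B V"
  unfolding morse_index_eq_SUP_card[OF assms(1)] using assms(2) by (intro SUP_upper) simp

lemma morse_index_mono: "V \<subseteq> V' \<Longrightarrow> morse_index B V \<le> morse_index B V'"
  unfolding morse_index_def by (rule SUP_subset_mono) auto

text \<open>The law of inertia. Every negative definite subspace projects orthogonally to the span of C, and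
  the projection is injective, since the kernel lies in the complement of C, where the form is
  nonnegative.\<close>

lemma morse_index_eq_card:
  assumes V: "cfun.subspace V" "V \<subseteq> E" and C: "negative_basis C V"
    and nonneg: "\<And>p. p \<in> V \<Longrightarrow> p \<in> perp (cfun.span C) \<Longrightarrow> Re (B p p) \<ge> 0"
  shows "morse_index B V = enat (card C)"
proof (rule antisym)
  show "enat (card C) \<le> morse_index B V" using card_negative_basis_le[OF V(1) C] .
  have C': "finite C" "cfun.span C \<subseteq> V" "negative_definite_on B (cfun.span C)"
    using C by (auto simp: negative_basis_def)
  have CE: "C \<subseteq> E" using C'(2) V(2) cfun.span_superset by blast
  interpret pair: vector_space_pair "cscale :: complex \<Rightarrow> (real \<Rightarrow> complex^'m) \<Rightarrow> _" "cscale :: complex \<Rightarrow> (real \<Rightarrow> complex^'m) \<Rightarrow> _"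
    by unfold_locales
  have "card D \<le> card C" if D: "negative_basis D V" for D
  proof -
    have D': "finite D" "cfun.independent D" "cfun.span D \<subseteq> V" "negative_definite_on B (cfun.span D)"
      using D by (auto simp: negative_basis_def)
    have DE: "D \<subseteq> E" using D'(3) V(2) cfun.span_superset by blast
    have "\<forall>d\<in>D. \<exists>a\<in>cfun.span C. d - a \<in> perp (cfun.span C)"
      using orthogonal_projection_exists[OF C'(1) CE C'(3)] DE by blast
    then obtain f where f: "\<And>d. d \<in> D \<Longrightarrow> f d \<in> cfun.span C \<and> d - f d \<in> perp (cfun.span C)"
      by metis
    \<comment> \<open>The orthogonal projection, prescribed on the basis D and extended linearly to all loops.\<close>
    define \<pi> where "\<pi> = pair.construct D f"
    have lin: "Vector_Spaces.linear cscale cscale \<pi>"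
      unfolding \<pi>_def by (rule pair.linear_construct[OF D'(2)])
    interpret \<pi>: Vector_Spaces.linear cscale cscale \<pi> by (rule lin)
    have \<pi>_f: "\<pi> d = f d" if "d \<in> D" for d
      unfolding \<pi>_def by (rule pair.construct_basis[OF D'(2) that])
    have span: "\<pi> w \<in> cfun.span C \<and> w - \<pi> w \<in> perp (cfun.span C)" if "w \<in> cfun.span D" for w
      using that
    proof (induction rule: cfun.span_induct_alt)
      case base
      then show ?case
        unfolding \<pi>.zero diff_self
        using cfun.subspace_0[OF subspace_perp[OF span_subset_E[OF CE]]] cfun.span_zero by blast
    next
      case (step c x y)
      have "\<pi> (cscale c x + y) \<in> cfun.span C"
        unfolding \<pi>.add \<pi>.scale using step f \<pi>_f by (intro cfun.span_add cfun.span_scale) auto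
      moreover have "cscale c x + y - \<pi> (cscale c x + y) = cscale c (x - f x) + (y - \<pi> y)"
        using \<pi>_f[OF step(1)] by (simp add: \<pi>.add \<pi>.scale cfun.scale_right_diff_distrib)
      moreover have "cscale c (x - f x) + (y - \<pi> y) \<in> perp (cfun.span C)"
        using step(1,2) f subspace_perp[OF span_subset_E[OF CE]]
        by (intro cfun.subspace_add cfun.subspace_scale) blast+
      ultimately show ?case by metis
    qed
    have "inj_on \<pi> (cfun.span D)"
    proof (subst \<pi>.inj_on_iff_eq_0)
      show "cfun.subspace (cfun.span D)" by simp
      show "\<forall>w\<in>cfun.span D. \<pi> w = 0 \<longrightarrow> w = 0"
      proof (intro ballI impI)
        fix w assume w: "w \<in> cfun.span D" "\<pi> w = 0"
        then have "w \<in> perp (cfun.span C)" using span[of w] by simp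
        then have "Re (B w w) \<ge> 0" using nonneg w D'(3) by blast
        then show "w = 0" using D'(4) w(1) by (force simp: negative_definite_on_def)
      qed
    qed
    then have "cfun.independent (\<pi> ` D)" "inj_on \<pi> D"
      using \<pi>.independent_injective_image[OF D'(2)] cfun.span_superset inj_on_subset by blast+
    moreover have "\<pi> ` D \<subseteq> cfun.span C" using span cfun.span_base by blast
    ultimately show ?thesis
      using cfun.independent_span_bound[OF C'(1), of "\<pi> ` D"] by (simp add: card_image)
  qed
  then show "morse_index B V \<le> enat (card C)"
    unfolding morse_index_eq_SUP_card[OF V(1)] by (auto intro!: SUP_least)
qed

text \<open>A negative basis of maximal size has a nonnegative complement: a negative vector p in the complement
  could be added to it, since for w = z + k p with z in the span of C the mixed terms vanish.\<close>

lemma finite_morse_index_attained: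
  assumes V: "cfun.subspace V" "V \<subseteq> E" and "morse_index B V \<noteq> \<infinity>"
  obtains C where "negative_basis C V"
    "\<And>p. p \<in> V \<Longrightarrow> p \<in> perp (cfun.span C) \<Longrightarrow> Re (B p p) \<ge> 0"
proof -
  obtain r where r: "morse_index B V = enat r" using assms(3) by auto
  have bound: "card C \<le> r" if "negative_basis C V" for C
    using card_negative_basis_le[OF V(1) that] r by simp
  have empty: "negative_basis {} V"
    using V(1) by (simp add: negative_basis_def negative_definite_on_def cfun.subspace_0 cfun.dependent_def)
  obtain C where C: "negative_basis C V" and max: "\<And>D. negative_basis D V \<Longrightarrow> card D \<le> card C"
    using ex_has_greatest_nat[of "\<lambda>C. negative_basis C V" "{}" card "Suc r"] empty bound
    by (auto simp: less_Suc_eq_le)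
  have C': "finite C" "cfun.independent C" "cfun.span C \<subseteq> V" "negative_definite_on B (cfun.span C)"
    using C by (auto simp: negative_basis_def)
  have "Re (B p p) \<ge> 0" if p: "p \<in> V" "p \<in> perp (cfun.span C)" for p
  proof (rule ccontr)
    assume neg: "\<not> Re (B p p) \<ge> 0"
    have pE: "p \<in> E" using p V by auto
    have notin: "p \<notin> cfun.span C"
    proof
      assume "p \<in> cfun.span C"
      then have "herm_part p p = 0" using p by (simp add: perp_def)
      then show False using neg Re_herm_part_self[of p] by simp
    qed
    have "negative_basis (insert p C) V"
      unfolding negative_basis_def
    proof (intro conjI)
      show "finite (insert p C)" using C' by simp
      show "cfun.independent (insert p C)" using C' notin by (simp add: cfun.independent_insertI)
      have "insert p C \<subseteq> V" using p C' cfun.span_superset by blast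
      then show "cfun.span (insert p C) \<subseteq> V" using V by (simp add: cfun.span_minimal)
      show "negative_definite_on B (cfun.span (insert p C))"
        unfolding negative_definite_on_def
      proof (intro ballI impI)
        fix w assume w: "w \<in> cfun.span (insert p C)" "w \<noteq> 0"
        obtain k where k: "w - cscale k p \<in> cfun.span C"
          using w by (auto simp: cfun.span_insert)
        define z where "z = w - cscale k p"
        have z: "z \<in> cfun.span C" "z \<in> E" using k C' V by (auto simp: z_def)
        have w_eq: "w = z + cscale k p" by (simp add: z_def)
        have kp: "cscale k p \<in> E" using pE subspace_E by (simp add: cfun.subspace_scale)
        have wE: "w \<in> E" unfolding w_eq using z kp subspace_E by (simp add: cfun.subspace_add)
        have pz: "herm_part p z = 0" using p z by (simp add: perp_def)
        then have zp: "herm_part z p = 0" using herm_part_commute[of z p] by simp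
        have "herm_part w w = herm_part z z + k * cnj k * herm_part p p"
          using pz zp z kp pE wE unfolding w_eq
          by (simp add: herm_part_add_left herm_part_add_right herm_part_scale_left
              herm_part_scale_right cfun.subspace_add subspace_E algebra_simps)
        then have "herm_part w w = of_real (2 * Re (B z z) + (cmod k)\<^sup>2 * (2 * Re (B p p)))"
          by (simp add: complex_norm_square[symmetric] herm_part_self_eq_of_real)
        then have eq: "Re (B w w) = Re (B z z) + (cmod k)\<^sup>2 * Re (B p p)"
          using Re_herm_part_self[of w] by simp
        have z_le: "Re (B z z) \<le> 0"
        proof (cases "z = 0")
          case True
          then show ?thesis using Re_herm_part_self[of z] herm_part_zero_left[OF z(2)] by simp
        next
          case False
          then show ?thesis using C'(4) z by (force simp: negative_definite_on_def)
        qed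
        show "Re (B w w) < 0"
        proof (cases "k = 0")
          case True
          then have "w = z" using w_eq by simp
          then show ?thesis using C'(4) z w by (force simp: negative_definite_on_def)
        next
          case False
          then have "(cmod k)\<^sup>2 * Re (B p p) < 0" using neg by (simp add: mult_less_0_iff not_le)
          then show ?thesis using eq z_le by simp
        qed
      qed
    qed
    then have "card (insert p C) \<le> card C" by (rule max)
    moreover have "p \<notin> C" using notin cfun.span_base by blast
    ultimately show False using C'(1) by simp
  qed
  then show ?thesis using that C by blast
qed

definition mutually_orthogonal where
  "mutually_orthogonal V W \<longleftrightarrow> (\<forall>v\<in>V. \<forall>w\<in>W. B v w = 0 \<and> B w v = 0)"

text \<open>If one summand has infinite index, so has the sum, which contains it. Otherwise take maximal
  negative bases C1 and C2 of the summands. The union is a negative basis of the sum, and its complement is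
  nonnegative because the two components of a vector of the complement are orthogonal to C1 and C2,
  so the law of inertia counts its elements. The union is independent because a common vector of both
  spans is orthogonal to itself and therefore zero.\<close>

lemma morse_index_orthogonal_sum:
  assumes V1: "cfun.subspace V1" "V1 \<subseteq> E" and V2: "cfun.subspace V2" "V2 \<subseteq> E"
    and orth: "mutually_orthogonal V1 V2"
  shows "morse_index B {u + v | u v. u \<in> V1 \<and> v \<in> V2} = morse_index B V1 + morse_index B V2"
    (is "morse_index B ?V = _")
proof -
  have V: "cfun.subspace ?V" by (rule cfun.subspace_sums[OF V1(1) V2(1)])
  have VE: "?V \<subseteq> E" using V1 V2 subspace_E by (auto simp: cfun.subspace_add subset_iff)
  have "u \<in> ?V" if "u \<in> V1" for u
    using that cfun.subspace_0[OF V2(1)] by (intro CollectI exI[of _ u] exI[of _ 0]) simp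
  then have sub1: "V1 \<subseteq> ?V" by blast
  have "u \<in> ?V" if "u \<in> V2" for u
    using that cfun.subspace_0[OF V1(1)] by (intro CollectI exI[of _ 0] exI[of _ u]) simp
  then have sub2: "V2 \<subseteq> ?V" by blast
  have split: "Re (B (u + v) (u + v)) = Re (B u u) + Re (B v v)" if "u \<in> V1" "v \<in> V2" for u v
  proof -
    have "u \<in> E" "v \<in> E" "u + v \<in> E" using that V1 V2 subspace_E by (auto simp: cfun.subspace_add subset_iff)
    then have "B (u + v) (u + v) = B u u + B v v"
      using that orth by (simp add: add_left add_right mutually_orthogonal_def)
    then show ?thesis by simp
  qed
  show ?thesis
  proof (cases "morse_index B V1 = \<infinity> \<or> morse_index B V2 = \<infinity>")
    case True
    then have "morse_index B ?V = \<infinity>"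
      using morse_index_mono[OF sub1] morse_index_mono[OF sub2] by auto
    then show ?thesis using True by auto
  next
    case False
    obtain C1 where C1: "negative_basis C1 V1"
      and nn1: "\<And>p. p \<in> V1 \<Longrightarrow> p \<in> perp (cfun.span C1) \<Longrightarrow> Re (B p p) \<ge> 0"
      using finite_morse_index_attained[OF V1] False by blast
    obtain C2 where C2: "negative_basis C2 V2"
      and nn2: "\<And>p. p \<in> V2 \<Longrightarrow> p \<in> perp (cfun.span C2) \<Longrightarrow> Re (B p p) \<ge> 0"
      using finite_morse_index_attained[OF V2] False by blast
    note D1 = C1[unfolded negative_basis_def] and D2 = C2[unfolded negative_basis_def]
    have span12: "cfun.span (C1 \<union> C2) = {u + v | u v. u \<in> cfun.span C1 \<and> v \<in> cfun.span C2}"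
      by (rule cfun.span_Un)
    have inter: "cfun.span C1 \<inter> cfun.span C2 \<subseteq> {0}"
    proof
      fix w assume w: "w \<in> cfun.span C1 \<inter> cfun.span C2"
      then have "B w w = 0" using D1 D2 orth by (auto simp: mutually_orthogonal_def subset_iff)
      then show "w \<in> {0}" using w D1 by (force simp: negative_definite_on_def)
    qed
    have disj: "C1 \<inter> C2 = {}"
    proof (rule ccontr)
      assume "C1 \<inter> C2 \<noteq> {}"
      then obtain w where w: "w \<in> C1" "w \<in> C2" by blast
      then have "w = 0" using inter cfun.span_base by blast
      then show False using w D1 cfun.dependent_zero by blast
    qed
    have indep: "cfun.independent (C1 \<union> C2)"
      using D1 D2 inter by (intro independent_Un_if_spans_meet_trivially) auto
    have neg: "Re (B (a + b) (a + b)) < 0"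
      if "a \<in> cfun.span C1" "b \<in> cfun.span C2" "a + b \<noteq> 0" for a b
    proof -
      have eq: "Re (B (a + b) (a + b)) = Re (B a a) + Re (B b b)" using split that D1 D2 by auto
      \<comment> \<open>A summand that vanishes must contribute nothing.\<close>
      have zero: "B 0 0 = 0" using scale_left[of 0 0 0] subspace_E by (simp add: cfun.subspace_0)
      have "a = 0 \<or> Re (B a a) < 0" "b = 0 \<or> Re (B b b) < 0"
        using that D1 D2 by (auto simp: negative_definite_on_def)
      then show ?thesis using eq that(3) zero by auto
    qed
    have C: "negative_basis (C1 \<union> C2) ?V"
      unfolding negative_basis_def
    proof (intro conjI)
      show "cfun.span (C1 \<union> C2) \<subseteq> ?V" unfolding span12 using D1 D2 by blast
      show "negative_definite_on B (cfun.span (C1 \<union> C2))"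
        unfolding span12 negative_definite_on_def using neg by auto
    qed (use D1 D2 indep in auto)
    have nonneg: "Re (B p p) \<ge> 0" if p: "p \<in> ?V" "p \<in> perp (cfun.span (C1 \<union> C2))" for p
    proof -
      obtain u v where uv: "p = u + v" "u \<in> V1" "v \<in> V2" using p by auto
      have uvE: "u \<in> E" "v \<in> E" using uv V1 V2 by auto
      have cross: "herm_part a b = 0" "herm_part b a = 0" if "a \<in> V1" "b \<in> V2" for a b
        using orth that by (simp_all add: herm_part_def mutually_orthogonal_def)
      have "herm_part u w = 0" if w: "w \<in> cfun.span C1" for w
      proof -
        have "w \<in> cfun.span (C1 \<union> C2)" using w cfun.span_mono[of C1 "C1 \<union> C2"] by auto
        then have "herm_part (u + v) w = 0" using p uv by (simp add: perp_def)
        moreover have "w \<in> V1" "w \<in> E" using w D1 V1 by auto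
        ultimately show ?thesis using cross(2)[of w v] uv uvE by (simp add: herm_part_add_left)
      qed
      then have "Re (B u u) \<ge> 0" using nn1 uv uvE by (simp add: perp_def)
      moreover have "herm_part v w = 0" if w: "w \<in> cfun.span C2" for w
      proof -
        have "w \<in> cfun.span (C1 \<union> C2)" using w cfun.span_mono[of C2 "C1 \<union> C2"] by auto
        then have "herm_part (u + v) w = 0" using p uv by (simp add: perp_def)
        moreover have "w \<in> V2" "w \<in> E" using w D2 V2 by auto
        ultimately show ?thesis using cross(1)[of u w] uv uvE by (simp add: herm_part_add_left)
      qed
      then have "Re (B v v) \<ge> 0" using nn2 uv uvE by (simp add: perp_def)
      ultimately show ?thesis using split uv by simp
    qed
    have "morse_index B ?V = enat (card (C1 \<union> C2))"
      by (rule morse_index_eq_card[OF V VE C nonneg])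
    moreover have "morse_index B V1 = enat (card C1)" by (rule morse_index_eq_card[OF V1 C1 nn1])
    moreover have "morse_index B V2 = enat (card C2)" by (rule morse_index_eq_card[OF V2 C2 nn2])
    ultimately show ?thesis using D1 D2 disj by (simp add: card_Un_disjoint)
  qed
qed

lemma morse_index_orthogonal_family:
  assumes "finite K"
    and V: "\<And>k. k \<in> K \<Longrightarrow> cfun.subspace (V k)" "\<And>k. k \<in> K \<Longrightarrow> V k \<subseteq> E"
    and orth: "\<And>j k. j \<in> K \<Longrightarrow> k \<in> K \<Longrightarrow> j \<noteq> k \<Longrightarrow> mutually_orthogonal (V j) (V k)"
  shows "morse_index B (cfun.span (\<Union>k\<in>K. V k)) = (\<Sum>k\<in>K. morse_index B (V k))"
  using assms
proof (induction K rule: finite_induct)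
  case empty
  have "cfun.dim W = 0" if "W \<subseteq> {0}" for W :: "(real \<Rightarrow> complex^'m) set"
    using cfun.dim_le_card[of W "{}"] that by simp
  then have "morse_index B (cfun.span {}) \<le> 0"
    unfolding morse_index_def by (intro SUP_least) (auto simp: zero_enat_def)
  then show ?case by simp
next
  case (insert k K)
  let ?W = "cfun.span (\<Union>k\<in>K. V k)"
  have WE: "?W \<subseteq> E" using insert.prems by (intro span_subset_E) auto
  have "mutually_orthogonal (V k) ?W"
  proof -
    have "?W \<subseteq> {w\<in>E. \<forall>v\<in>V k. B v w = 0 \<and> B w v = 0}"
    proof (rule cfun.span_minimal)
      show "(\<Union>k\<in>K. V k) \<subseteq> {w\<in>E. \<forall>v\<in>V k. B v w = 0 \<and> B w v = 0}"
        using insert unfolding mutually_orthogonal_def by (auto simp: subset_iff) (metis+)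
      have "V k \<subseteq> E" using insert by simp
      moreover have "B v 0 = 0 \<and> B 0 v = 0" if "v \<in> E" for v
        using that scale_left[of v v 0] scale_right[of v v 0] by simp
      ultimately show "cfun.subspace {w\<in>E. \<forall>v\<in>V k. B v w = 0 \<and> B w v = 0}"
        using subspace_E unfolding cfun.subspace_def
        by (auto simp: add_left add_right scale_left scale_right subset_iff)
    qed
    then show ?thesis by (auto simp: mutually_orthogonal_def)
  qed
  then have "morse_index B {u + v | u v. u \<in> V k \<and> v \<in> ?W} = morse_index B (V k) + morse_index B ?W"
    using insert WE by (intro morse_index_orthogonal_sum) auto
  moreover have "cfun.span (\<Union>k\<in>insert k K. V k) = {u + v | u v. u \<in> V k \<and> v \<in> ?W}"
  proof -
    have eq: "cfun.span (V k) = V k" using insert.prems(1)[of k] by simp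
    show ?thesis using cfun.span_Un[of "V k" "\<Union>k\<in>K. V k"] unfolding eq by simp
  qed
  ultimately show ?case using insert by simp
qed

end

section \<open>Isometric actions of the dihedral group\<close>

lemma zeta_powi: "zeta n powi k = exp (2 * of_real pi * \<i> * of_int k / of_nat n)"
  unfolding zeta_def by (simp add: exp_power_int algebra_simps)

lemma zeta_powi_mult: "zeta n powi j * zeta n powi k = zeta n powi (j + k)"
  by (simp add: zeta_powi exp_add[symmetric] add_divide_distrib algebra_simps)

lemma cnj_zeta_powi: "cnj (zeta n powi k) = zeta n powi (- k)"
  by (simp add: zeta_powi exp_cnj)

lemma zeta_powi_eq_1_iff:
  assumes "n \<ge> 1"
  shows "zeta n powi k = 1 \<longleftrightarrow> int n dvd k"
proof -
  have n: "real n \<noteq> 0" using assms by simp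
  have arg: "2 * of_real pi * \<i> * of_int k / of_nat n = \<i> * of_real (2 * pi * of_int k / of_nat n)"
    by simp
  have "zeta n powi k = 1 \<longleftrightarrow> (\<exists>j::int. 2 * pi * of_int k / of_nat n = of_int (2 * j) * pi)"
    unfolding zeta_powi exp_eq_1 arg by simp
  also have "\<dots> \<longleftrightarrow> (\<exists>j::int. real_of_int k = of_int j * of_nat n)"
    using n by (simp add: field_simps)
  also have "\<dots> \<longleftrightarrow> (\<exists>j::int. k = j * int n)"
    by (metis of_int_eq_iff of_int_mult of_int_of_nat_eq)
  finally show ?thesis by (auto simp: dvd_def mult.commute)
qed

text \<open>The orthogonality relations of the characters of the cyclic group, as a geometric sum.\<close>

lemma sum_zeta_powi:
  assumes "n \<ge> 1"
  shows "(\<Sum>k<n. zeta n powi (int k * j)) = (if int n dvd j then of_nat n else 0)"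
proof -
  define z where "z = zeta n powi j"
  have powi: "zeta n powi (int k * j) = z ^ k" for k
    unfolding z_def by (simp add: power_int_mult[symmetric] mult.commute power_int_of_nat[symmetric] del: power_int_of_nat)
  have "z ^ n = 1"
    unfolding powi[symmetric] using zeta_powi_eq_1_iff[OF assms] by simp
  then show ?thesis
    using zeta_powi_eq_1_iff[OF assms, of j] geometric_sum[of z n]
    unfolding powi z_def[symmetric] by (cases "z = 1") auto
qed

text \<open>The rotation \<sigma> and the reflection \<nu> generate an action of the dihedral group. The relation
  \<sigma> \<nu> \<sigma> = \<nu> is stated without inverses because \<sigma> has order n only on E.\<close>

locale dihedral_form = sesquilinear_form B E
  for B :: "(real \<Rightarrow> complex^'m) \<Rightarrow> (real \<Rightarrow> complex^'m) \<Rightarrow> complex" and E +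
  fixes \<sigma> \<nu> :: "(real \<Rightarrow> complex^'m) \<Rightarrow> (real \<Rightarrow> complex^'m)" and n :: nat
  assumes n_pos: "n \<ge> 1"
    and \<sigma>_add: "\<sigma> (u + v) = \<sigma> u + \<sigma> v" and \<sigma>_scale: "\<sigma> (cscale c u) = cscale c (\<sigma> u)"
    and \<nu>_add: "\<nu> (u + v) = \<nu> u + \<nu> v" and \<nu>_scale: "\<nu> (cscale c u) = cscale c (\<nu> u)"
    and \<sigma>_E: "u \<in> E \<Longrightarrow> \<sigma> u \<in> E" and \<nu>_E: "u \<in> E \<Longrightarrow> \<nu> u \<in> E"
    and \<sigma>_power_n: "u \<in> E \<Longrightarrow> (\<sigma> ^^ n) u = u"
    and \<nu>_\<nu>: "\<nu> (\<nu> u) = u" and \<sigma>_\<nu>_\<sigma>: "\<sigma> (\<nu> (\<sigma> u)) = \<nu> u"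
    and \<sigma>_invariant: "u \<in> E \<Longrightarrow> v \<in> E \<Longrightarrow> B (\<sigma> u) (\<sigma> v) = B u v"
    and \<nu>_invariant: "u \<in> E \<Longrightarrow> v \<in> E \<Longrightarrow> B (\<nu> u) (\<nu> v) = B u v"
begin

definition refl :: "nat \<Rightarrow> (real \<Rightarrow> complex^'m) \<Rightarrow> (real \<Rightarrow> complex^'m)" where
  "refl h u = \<nu> ((\<sigma> ^^ h) u)"

lemma \<sigma>_power_commute: "\<sigma> ((\<sigma> ^^ h) u) = (\<sigma> ^^ h) (\<sigma> u)"
  by (simp add: funpow_swap1)

lemma \<sigma>_power_E: "u \<in> E \<Longrightarrow> (\<sigma> ^^ h) u \<in> E"
  by (induction h) (auto simp: \<sigma>_E)

text \<open>This makes \<nu> \<sigma>^h an involution, for every h.\<close>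

lemma \<sigma>_power_\<nu>_\<sigma>_power: "(\<sigma> ^^ h) (\<nu> ((\<sigma> ^^ h) u)) = \<nu> u"
proof (induction h arbitrary: u)
  case (Suc h)
  have "(\<sigma> ^^ Suc h) (\<nu> ((\<sigma> ^^ Suc h) u)) = (\<sigma> ^^ h) (\<sigma> (\<nu> (\<sigma> ((\<sigma> ^^ h) u))))"
    by (simp add: funpow_swap1)
  then show ?case using Suc by (simp add: \<sigma>_\<nu>_\<sigma>)
qed simp

lemma refl_refl: "refl h (refl h u) = u"
  by (simp add: refl_def \<sigma>_power_\<nu>_\<sigma>_power \<nu>_\<nu>)

lemma \<sigma>_refl_\<sigma>: "\<sigma> (refl h (\<sigma> u)) = refl h u"
  by (simp add: refl_def \<sigma>_power_commute[symmetric] \<sigma>_\<nu>_\<sigma>)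

lemma refl_E: "u \<in> E \<Longrightarrow> refl h u \<in> E"
  by (simp add: refl_def \<sigma>_power_E \<nu>_E)

lemma refl_invariant:
  assumes "u \<in> E" "v \<in> E"
  shows "B (refl h u) (refl h v) = B u v"
proof -
  have "B ((\<sigma> ^^ h) u) ((\<sigma> ^^ h) v) = B u v"
    by (induction h) (use assms in \<open>auto simp: \<sigma>_invariant \<sigma>_power_E\<close>)
  then show ?thesis using assms by (simp add: refl_def \<nu>_invariant \<sigma>_power_E)
qed

lemma \<sigma>_power_add: "(\<sigma> ^^ h) (u + v) = (\<sigma> ^^ h) u + (\<sigma> ^^ h) v"
  by (induction h) (simp_all add: \<sigma>_add)

lemma \<sigma>_power_scale: "(\<sigma> ^^ h) (cscale c u) = cscale c ((\<sigma> ^^ h) u)"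
  by (induction h) (simp_all add: \<sigma>_scale)

lemma refl_add: "refl h (u + v) = refl h u + refl h v"
  by (simp add: refl_def \<sigma>_power_add \<nu>_add)

lemma refl_scale: "refl h (cscale c u) = cscale c (refl h u)"
  by (simp add: refl_def \<sigma>_power_scale \<nu>_scale)

lemma subspace_eigenspace:
  assumes "cfun.subspace V" and add: "\<And>u v. f (u + v) = f u + f v"
    and scale: "\<And>c u. f (cscale c u) = cscale c (f u)"
  shows "cfun.subspace {u \<in> V. f u = cscale a u}"
proof -
  have "f 0 = 0" using add[of 0 0] by simp
  then show ?thesis
    using assms unfolding cfun.subspace_def
    by (auto simp: cfun.scale_right_distrib mult.commute)
qed

text \<open>For eigenvectors u and v invariance gives B u v = a * cnj b * B u v. The hypothesis is thus that
  a and b differ, when they have modulus 1.\<close>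

lemma eigenspaces_mutually_orthogonal:
  assumes inv: "\<And>u v. u \<in> E \<Longrightarrow> v \<in> E \<Longrightarrow> B (f u) (f v) = B u v"
    and "a * cnj b \<noteq> 1"
  shows "mutually_orthogonal {u \<in> E. f u = cscale a u} {u \<in> E. f u = cscale b u}"
proof -
  have zero: "B u v = 0" if "u \<in> E" "v \<in> E" "f u = cscale a u" "f v = cscale b v" "a * cnj b \<noteq> 1" for a b u v
  proof -
    have "B u v = a * cnj b * B u v"
      using inv[OF that(1,2)] that scale_left[of u "cscale b v" a] scale_right[of v u b] subspace_E
      by (simp add: cfun.subspace_scale)
    then show ?thesis using that(5) by (metis mult_cancel_right1 mult.commute)
  qed
  have "b * cnj a \<noteq> 1"
    using assms(2) by (metis complex_cnj_cnj complex_cnj_mult complex_cnj_one mult.commute)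
  then show ?thesis using zero assms(2) unfolding mutually_orthogonal_def by blast
qed

definition eig :: "int \<Rightarrow> (real \<Rightarrow> complex^'m) set" where
  "eig k = {u \<in> E. \<sigma> u = cscale (zeta n powi k) u}"

text \<open>For k = 0 and 2 k = n both eigenspaces agree, and this is a single eigenspace again; a uniform
  formula spares the case distinction in all that follows.\<close>

definition isotypic :: "nat \<Rightarrow> (real \<Rightarrow> complex^'m) set" where
  "isotypic k = {u + v | u v. u \<in> eig (int k) \<and> v \<in> eig (- int k)}"

definition refl_eig :: "(real \<Rightarrow> complex^'m) set \<Rightarrow> nat \<Rightarrow> complex \<Rightarrow> (real \<Rightarrow> complex^'m) set" where
  "refl_eig V h s = {u \<in> V. refl h u = cscale s u}"

lemma subspace_eig: "cfun.subspace (eig k)"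
  unfolding eig_def by (intro subspace_eigenspace subspace_E \<sigma>_add \<sigma>_scale)

lemma eig_subset_E: "eig k \<subseteq> E" by (auto simp: eig_def)

lemma subspace_isotypic: "cfun.subspace (isotypic k)"
  unfolding isotypic_def by (intro cfun.subspace_sums subspace_eig)

lemma isotypic_subset_E: "isotypic k \<subseteq> E"
  using eig_subset_E subspace_E by (auto simp: isotypic_def cfun.subspace_add subset_iff)

lemma subspace_refl_eig: "cfun.subspace V \<Longrightarrow> cfun.subspace (refl_eig V h s)"
  unfolding refl_eig_def by (intro subspace_eigenspace refl_add refl_scale)

lemma eig_cong: 
  assumes "int n dvd j - k" shows "eig j = eig k"
proof -
  have "zeta n powi j = zeta n powi (j - k) * zeta n powi k" by (simp add: zeta_powi_mult)
  also have "zeta n powi (j - k) = 1" using assms zeta_powi_eq_1_iff[OF n_pos] by blast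
  finally show ?thesis by (simp add: eig_def)
qed

lemma eig_mutually_orthogonal: "\<not> int n dvd j - k \<Longrightarrow> mutually_orthogonal (eig j) (eig k)"
  unfolding eig_def using zeta_powi_eq_1_iff[OF n_pos, of "j - k"]
  by (intro eigenspaces_mutually_orthogonal \<sigma>_invariant) (auto simp: cnj_zeta_powi zeta_powi_mult simp del: complex_cnj_power_int)

text \<open>The four differences of the exponents \<plusminus>j and \<plusminus>k are nonzero and smaller than n in absolute value,
  so all four pairs of eigenvalues are distinct.\<close>

lemma isotypic_mutually_orthogonal:
  assumes "j \<le> n div 2" "k \<le> n div 2" "j \<noteq> k"
  shows "mutually_orthogonal (isotypic j) (isotypic k)"
proof -
  have small: "\<not> int n dvd a" if "a \<noteq> 0" "\<bar>a\<bar> < int n" for a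
    using that zdvd_not_zless[of "\<bar>a\<bar>" "int n"] by auto
  have lt: "j + k < n" "j + k > 0" using assms by auto
  have "\<not> int n dvd int j - int k" "\<not> int n dvd int j - (- int k)"
    "\<not> int n dvd - int j - int k" "\<not> int n dvd - int j - (- int k)"
    using lt assms by (intro small; linarith)+
  note orth = this[THEN eig_mutually_orthogonal, unfolded mutually_orthogonal_def]
  have inE: "u \<in> eig a \<Longrightarrow> u \<in> E" for u a using eig_subset_E by auto
  have "B (u + v) (u' + v') = 0 \<and> B (u' + v') (u + v) = 0"
    if "u \<in> eig (int j)" "v \<in> eig (- int j)" "u' \<in> eig (int k)" "v' \<in> eig (- int k)" for u v u' v'
  proof -
    have "u \<in> E" "v \<in> E" "u' \<in> E" "v' \<in> E" "u' + v' \<in> E" "u + v \<in> E"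
      using that inE subspace_E by (auto intro!: cfun.subspace_add)
    then show ?thesis using that orth by (simp add: add_left add_right)
  qed
  then show ?thesis unfolding mutually_orthogonal_def isotypic_def by blast
qed

text \<open>Reflections invert the rotation, hence exchange the eigenspaces of conjugate eigenvalues. This is why
  eigenspaces have to be paired before a reflection can act on them.\<close>

lemma refl_maps_eig:
  assumes "u \<in> eig k" shows "refl h u \<in> eig (- k)"
proof -
  have "refl h u = cscale (zeta n powi k) (\<sigma> (refl h u))"
    using assms \<sigma>_refl_\<sigma>[of h u] by (simp add: eig_def refl_scale \<sigma>_scale)
  then have "cscale (zeta n powi (- k)) (refl h u) = cscale (zeta n powi (- k) * zeta n powi k) (\<sigma> (refl h u))"
    by (metis cfun.scale_scale)
  then show ?thesis using assms by (simp add: eig_def zeta_powi_mult refl_E)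
qed

text \<open>Averaging the rotates of u against a character projects to its eigenspace.\<close>

definition eig_part :: "nat \<Rightarrow> (real \<Rightarrow> complex^'m) \<Rightarrow> (real \<Rightarrow> complex^'m)" where
  "eig_part k u = cscale (1 / of_nat n) (\<Sum>j<n. cscale (zeta n powi (- (int j * int k))) ((\<sigma> ^^ j) u))"

lemma eig_part_in_eig:
  assumes "u \<in> E" shows "eig_part k u \<in> eig (int k)"
proof -
  define f where "f j = cscale (zeta n powi (- (int j * int k))) ((\<sigma> ^^ j) u)" for j
  have part: "eig_part k u = cscale (1 / of_nat n) (\<Sum>j<n. f j)" by (simp add: eig_part_def f_def)
  have \<sigma>_sum: "\<sigma> (\<Sum>j<m. f j) = (\<Sum>j<m. \<sigma> (f j))" for m
  proof (induction m)
    case 0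
    show ?case using \<sigma>_add[of 0 0] by simp
  qed (simp add: \<sigma>_add)
  have "\<sigma> (f j) = cscale (zeta n powi (int k)) (f (Suc j))" for j
  proof -
    have "zeta n powi (int k) * zeta n powi (- (int (Suc j) * int k)) = zeta n powi (- (int j * int k))"
      unfolding zeta_powi_mult by (simp add: algebra_simps)
    then show ?thesis unfolding f_def \<sigma>_scale cfun.scale_scale by simp
  qed
  then have "\<sigma> (\<Sum>j<n. f j) = cscale (zeta n powi (int k)) (\<Sum>j<n. f (Suc j))"
    by (simp add: \<sigma>_sum cfun.scale_sum_right)
  also have "(\<Sum>j<n. f (Suc j)) = (\<Sum>j<n. f j)"
  proof -
    have "f n = f 0"
      using \<sigma>_power_n[OF assms] zeta_powi_eq_1_iff[OF n_pos, of "- (int n * int k)"] by (simp add: f_def)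
    moreover have "(\<Sum>j<n. f (Suc j)) + f 0 = (\<Sum>j<n. f j) + f n"
      using sum.lessThan_Suc_shift[of f n] by (simp add: add.commute)
    ultimately show ?thesis by simp
  qed
  finally have "\<sigma> (eig_part k u) = cscale (zeta n powi (int k)) (eig_part k u)"
    by (simp add: part \<sigma>_scale mult.commute)
  moreover have "eig_part k u \<in> E"
    unfolding eig_part_def using subspace_E assms
    by (intro cfun.subspace_scale cfun.subspace_sum \<sigma>_power_E)
  ultimately show ?thesis by (simp add: eig_def)
qed

lemma sum_eig_part:
  "(\<Sum>k<n. eig_part k u) = u"
proof -
  have n: "of_nat n \<noteq> (0::complex)" using n_pos by simp
  have "(\<Sum>k<n. eig_part k u)
      = cscale (1 / of_nat n) (\<Sum>j<n. \<Sum>k<n. cscale (zeta n powi (int k * (- int j))) ((\<sigma> ^^ j) u))"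
    unfolding eig_part_def cfun.scale_sum_right[symmetric]
    by (subst sum.swap) (simp add: mult.commute)
  also have "\<dots> = cscale (1 / of_nat n) (\<Sum>j<n. if j = 0 then cscale (of_nat n) u else 0)"
  proof (rule arg_cong[of _ _ "cscale (1 / of_nat n)"], rule sum.cong)
    fix j assume "j \<in> {..<n}"
    then have "int n dvd - int j \<longleftrightarrow> j = 0" by (auto dest: nat_dvd_not_less)
    then show "(\<Sum>k<n. cscale (zeta n powi (int k * (- int j))) ((\<sigma> ^^ j) u)) = (if j = 0 then cscale (of_nat n) u else 0)"
      unfolding cfun.scale_sum_left[symmetric] sum_zeta_powi[OF n_pos] by auto
  qed simp
  also have "\<dots> = u" using n n_pos by (simp add: sum.delta)
  finally show ?thesis .
qed

text \<open>Symmetrise the eigencomponents u_k of u: if the reflection multiplies u by s, then u is also the sum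
  of w_k = (u_k + s refl u_k) / 2, which lie in the sum of the eigenspaces of k and -k and which the
  reflection multiplies by s.\<close>

lemma refl_eig_eq_span_isotypic:
  assumes s: "s \<in> {1, -1}"
  shows "refl_eig E h s = cfun.span (\<Union>k\<in>{0..n div 2}. refl_eig (isotypic k) h s)"
proof
  show "cfun.span (\<Union>k\<in>{0..n div 2}. refl_eig (isotypic k) h s) \<subseteq> refl_eig E h s"
    using isotypic_subset_E
    by (intro cfun.span_minimal subspace_refl_eig subspace_E) (auto simp: refl_eig_def)
  show "refl_eig E h s \<subseteq> cfun.span (\<Union>k\<in>{0..n div 2}. refl_eig (isotypic k) h s)"
  proof
    fix u assume "u \<in> refl_eig E h s"
    then have uE: "u \<in> E" and u: "refl h u = cscale s u" by (auto simp: refl_eig_def)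
    define w where "w k = cscale (1/2) (eig_part k u + cscale s (refl h (eig_part k u)))" for k
    have refl_sum: "refl h (\<Sum>k<m. eig_part k u) = (\<Sum>k<m. refl h (eig_part k u))" for m
    proof (induction m)
      case 0
      show ?case using refl_add[of h 0 0] by simp
    qed (simp add: refl_add)
    have ss: "s * s = 1" using s by auto
    have "(\<Sum>k<n. w k) = cscale (1/2) (u + cscale s (refl h u))"
      unfolding w_def cfun.scale_sum_right[symmetric] sum.distrib refl_sum[symmetric] sum_eig_part ..
    also have "\<dots> = cscale (1/2) (cscale 2 u)"
      unfolding u by (simp add: ss cscale_def fun_eq_iff vec_eq_iff plus_fun_apply)
    also have "\<dots> = u" by simp
    finally have sum: "u = (\<Sum>k<n. w k)" ..
    have "w k \<in> (\<Union>k\<in>{0..n div 2}. refl_eig (isotypic k) h s)" if "k < n" for k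
    proof -
      have a: "cscale (1/2) (eig_part k u) \<in> eig (int k)"
        using eig_part_in_eig[OF uE] subspace_eig by (simp add: cfun.subspace_scale)
      have b: "cscale (1/2) (cscale s (refl h (eig_part k u))) \<in> eig (- int k)"
        using refl_maps_eig[OF eig_part_in_eig[OF uE]] subspace_eig by (simp add: cfun.subspace_scale)
      have "refl h (w k) = cscale s (w k)"
        by (simp add: w_def refl_scale refl_add refl_refl ss cfun.scale_right_distrib mult.assoc[symmetric] add.commute)
      moreover have "\<exists>k'\<in>{0..n div 2}. w k \<in> isotypic k'"
      proof (cases "k \<le> n div 2")
        case True
        have "w k \<in> isotypic k"
          unfolding isotypic_def w_def cfun.scale_right_distrib using a b by blast
        then show ?thesis using True by auto
      next
        case False
        \<comment> \<open>Exponents in the upper half are folded back to n - k.\<close>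
        have "eig (int k) = eig (- int (n - k))" "eig (- int k) = eig (int (n - k))"
          using that by (intro eig_cong; simp)+
        then have "w k \<in> isotypic (n - k)"
          unfolding isotypic_def w_def cfun.scale_right_distrib using a b
          by (subst add.commute) blast
        then show ?thesis using False by (intro bexI[of _ "n - k"]) auto
      qed
      ultimately show ?thesis by (auto simp: refl_eig_def)
    qed
    then show "u \<in> cfun.span (\<Union>k\<in>{0..n div 2}. refl_eig (isotypic k) h s)"
      unfolding sum by (intro cfun.span_sum cfun.span_base) auto
  qed
qed

text \<open>The two eigenspaces of an isometric involution are orthogonal and span the space.\<close>

theorem morse_index_refl_split:
  "morse_index B E = morse_index B (refl_eig E h 1) + morse_index B (refl_eig E h (- 1))"
proof -
  have eq: "E = {u + v | u v. u \<in> refl_eig E h 1 \<and> v \<in> refl_eig E h (- 1)}"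
  proof
    show "E \<subseteq> {u + v | u v. u \<in> refl_eig E h 1 \<and> v \<in> refl_eig E h (- 1)}"
    proof
      fix u assume u: "u \<in> E"
      define a b where "a = cscale (1/2) (u + refl h u)" and "b = cscale (1/2) (u + cscale (-1) (refl h u))"
      have "u = a + b"
      proof (rule ext)
        fix t
        have ab: "a t = (1/2) *s (u t + refl h u t)" "b t = (1/2) *s (u t + (-1) *s refl h u t)"
          unfolding a_def b_def by (simp_all only: cscale_def plus_fun_apply)
        show "u t = (a + b) t" unfolding plus_fun_apply ab by (simp add: vec_eq_iff algebra_simps)
      qed
      moreover have "a \<in> E" "b \<in> E"
        unfolding a_def b_def using u refl_E subspace_E
        by (blast intro: cfun.subspace_add cfun.subspace_scale)+
      moreover have "refl h a = cscale 1 a" "refl h b = cscale (- 1) b"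
        unfolding a_def b_def refl_scale refl_add refl_refl
        by (simp_all add: cscale_def fun_eq_iff vec_eq_iff field_simps plus_fun_apply)
      ultimately show "u \<in> {u + v | u v. u \<in> refl_eig E h 1 \<and> v \<in> refl_eig E h (- 1)}"
        unfolding refl_eig_def by blast
    qed
  qed (use subspace_E in \<open>auto simp: refl_eig_def cfun.subspace_add\<close>)
  have orth: "mutually_orthogonal (refl_eig E h 1) (refl_eig E h (- 1))"
    unfolding refl_eig_def by (intro eigenspaces_mutually_orthogonal refl_invariant) auto
  have sub: "refl_eig E h s \<subseteq> E" for s by (auto simp: refl_eig_def)
  show ?thesis
    using morse_index_orthogonal_sum[OF subspace_refl_eig[OF subspace_E] sub
        subspace_refl_eig[OF subspace_E] sub orth]
    unfolding eq[symmetric] .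
qed

text \<open>The isotypic components are orthogonal, hence so are their parts in an eigenspace of the reflection.\<close>

theorem morse_index_isotypic_split:
  assumes "s \<in> {1, -1}"
  shows "morse_index B (refl_eig E h s) = (\<Sum>k=0..n div 2. morse_index B (refl_eig (isotypic k) h s))"
  unfolding refl_eig_eq_span_isotypic[OF assms]
proof (rule morse_index_orthogonal_family)
  show "cfun.subspace (refl_eig (isotypic k) h s)" for k
    by (rule subspace_refl_eig[OF subspace_isotypic])
  show "refl_eig (isotypic k) h s \<subseteq> E" for k
    using isotypic_subset_E by (auto simp: refl_eig_def)
  show "mutually_orthogonal (refl_eig (isotypic j) h s) (refl_eig (isotypic k) h s)"
    if "j \<in> {0..n div 2}" "k \<in> {0..n div 2}" "j \<noteq> k" for j k
    using isotypic_mutually_orthogonal[of j k] that by (auto simp: mutually_orthogonal_def refl_eig_def)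
qed simp

lemma isotypic_self_paired:
  assumes "int n dvd 2 * int k"
  shows "isotypic k = eig (int k)"
proof -
  have "eig (- int k) = eig (int k)" using assms by (intro eig_cong) (simp add: dvd_diff_commute)
  then show ?thesis
    using cfun.subspace_add[OF subspace_eig] cfun.subspace_0[OF subspace_eig]
    unfolding isotypic_def by (auto, metis add.right_neutral)
qed

end

section \<open>Weak derivatives\<close>

lemma set_integrable_if_square:
  fixes g :: "real \<Rightarrow> 'a::euclidean_space"
  assumes [measurable]: "g \<in> borel_measurable borel"
    and "set_integrable lborel {a..b} (\<lambda>t. (norm (g t))\<^sup>2)"
  shows "set_integrable lborel {a..b} g"
proof (rule set_integrable_bound)
  show "set_integrable lborel {a..b} (\<lambda>t. 1 + (norm (g t))\<^sup>2)"
    using assms(2) borel_integrable_atLeastAtMost'[of a b "\<lambda>_. 1 :: real"]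
    by (intro set_integral_add) auto
  show "set_borel_measurable lborel {a..b} g" by (simp add: set_borel_measurable_def)
  have "norm (g t) \<le> norm (1 + (norm (g t))\<^sup>2)" for t
    using zero_le_power2[of "norm (g t) - 1"] norm_ge_zero[of "g t"]
    by (simp add: power2_eq_square algebra_simps del: norm_ge_zero)
  then show "AE t in lborel. t \<in> {a..b} \<longrightarrow> norm (g t) \<le> norm (1 + (norm (g t))\<^sup>2)" by simp
qed

text \<open>Cut off to a bounded interval, d has zero integral over every half-line, hence by the \<pi>-\<lambda> theorem
  over every Borel set, and a density with that property vanishes almost everywhere.\<close>

lemma AE_zero_if_interval_integrals_zero:
  fixes d :: "real \<Rightarrow> 'a::euclidean_space"
  assumes int: "\<And>a b. set_integrable lborel {a..b} d"
    and zero: "\<And>a b. a \<le> b \<Longrightarrow> (LBINT t:{a..b}. d t) = 0"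
  shows "AE t in lborel. d t = 0"
proof -
  have zero': "(LBINT t:{a..b}. d t) = 0" for a b
    using zero[of a b] by (cases "a \<le> b") (auto simp: set_lebesgue_integral_def)
  have "AE t in lborel. indicator {- real N..real N} t *\<^sub>R d t = 0" for N :: nat
  proof (rule sigma_finite_measure.density_zero[OF sigma_finite_lborel])
    define f where "f t = indicator {- real N..real N} t *\<^sub>R d t" for t
    show f: "integrable lborel (\<lambda>t. indicator {- real N..real N} t *\<^sub>R d t)"
      using int by (simp add: set_integrable_def)
    then have f_int: "integrable lborel f" by (simp add: f_def[abs_def])
    have set_f: "set_integrable lborel A f" if "A \<in> sets borel" for A
      using f_int that by (simp add: set_integrable_def integrable_mult_indicator)
    fix A :: "real set" assume "A \<in> sets lborel"
    then have A: "A \<in> sigma_sets UNIV (range atMost)"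
      by (simp add: borel_eq_atMost)
    have borel: "A \<in> sets borel" if "A \<in> sigma_sets UNIV (range (atMost :: real \<Rightarrow> _))" for A
      using that by (simp add: borel_eq_atMost)
    have "Int_stable (range (atMost :: real \<Rightarrow> _))" "range (atMost :: real \<Rightarrow> _) \<subseteq> Pow UNIV"
      by (auto simp: Int_stable_def)
    then have "(LBINT t:A. f t) = 0" using A
    proof (induction A rule: sigma_sets_induct_disjoint[consumes 3])
      case (basic A)
      then obtain a where "A = {..a}" by auto
      then have "(LBINT t:A. f t) = (LBINT t:{- real N..min a (real N)}. d t)"
        unfolding set_lebesgue_integral_def f_def
        by (intro Bochner_Integration.integral_cong) (auto simp: indicator_def)
      then show ?case using zero' by simp
    next
      case empty
      then show ?case by (simp add: set_lebesgue_integral_def)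
    next
      case (compl A)
      have "(LBINT t:UNIV - A. f t) = (LBINT t. f t) - (LBINT t:A. f t)"
        using set_integral_Un[of A "UNIV - A" lborel f] set_f borel[OF compl(1)]
        by (auto simp: set_lebesgue_integral_def Un_Diff_cancel)
      moreover have "(LBINT t. f t) = 0"
        using zero'[of "- real N" "real N"] by (simp add: f_def[abs_def] set_lebesgue_integral_def)
      ultimately show ?case using compl by simp
    next
      case (union A)
      have meas: "A i \<in> sets borel" for i using union borel by blast
      have "(LBINT t:(\<Union>i. A i). f t) = (\<Sum>i. (LBINT t:A i. f t))"
      proof (rule lebesgue_integral_countable_add)
        show "\<And>i. A i \<in> sets lborel" using meas by simp
        show "\<And>i j. i \<noteq> j \<Longrightarrow> A i \<inter> A j = {}" using union(1) by (auto simp: disjoint_family_on_def)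
        show "set_integrable lborel (\<Union>i. A i) f" using meas by (intro set_f) auto
      qed
      then show ?case using union by simp
    qed
    then show "set_lebesgue_integral lborel A (\<lambda>t. indicator {- real N..real N} t *\<^sub>R d t) = 0"
      by (simp add: f_def)
  qed
  then have "AE t in lborel. \<forall>N::nat. indicator {- real N..real N} t *\<^sub>R d t = 0"
    by (subst AE_all_countable) auto
  then show ?thesis
  proof eventually_elim
    case (elim t)
    obtain N :: nat where "\<bar>t\<bar> \<le> real N" using real_arch_simple by blast
    then show ?case using elim[rule_format, of N] by (simp add: indicator_def abs_le_iff)
  qed
qed

lemma has_weak_deriv_measurable: "has_weak_deriv u g \<Longrightarrow> g \<in> borel_measurable borel"
  by (simp add: has_weak_deriv_def)

lemma has_weak_deriv_set_integrable: "has_weak_deriv u g \<Longrightarrow> set_integrable lborel {a..b} g"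
  by (auto simp: has_weak_deriv_def intro: set_integrable_if_square)

text \<open>This makes integrals independent of the representative that weak_deriv chooses.\<close>

lemma has_weak_deriv_unique:
  assumes "has_weak_deriv u g" "has_weak_deriv u h"
  shows "AE t in lborel. g t = h t"
proof -
  note int = assms[THEN has_weak_deriv_set_integrable]
  have "AE t in lborel. g t - h t = 0"
  proof (rule AE_zero_if_interval_integrals_zero)
    show "set_integrable lborel {a..b} (\<lambda>t. g t - h t)" for a b
      using int by (intro set_integral_diff) auto
    show "(LBINT t:{a..b}. g t - h t) = 0" if "a \<le> b" for a b
      using int assms that by (subst set_integral_diff) (auto simp: has_weak_deriv_def)
  qed
  then show ?thesis by simp
qed

lemma has_weak_deriv_bounded_linear:
  fixes f :: "'a::euclidean_space \<Rightarrow> 'b::euclidean_space"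
  assumes f: "bounded_linear f" and u: "has_weak_deriv u g"
  shows "has_weak_deriv (\<lambda>t. f (u t)) (\<lambda>t. f (g t))"
proof -
  have [measurable]: "g \<in> borel_measurable borel" using u by (rule has_weak_deriv_measurable)
  have [measurable]: "f \<in> borel_measurable borel"
    using f by (intro borel_measurable_continuous_onI linear_continuous_on)
  obtain K where K: "\<And>x. norm (f x) \<le> norm x * K" using bounded_linear.bounded[OF f] by blast
  show ?thesis
    unfolding has_weak_deriv_def
  proof (intro conjI allI impI)
    fix a b :: real
    show "set_integrable lborel {a..b} (\<lambda>t. (norm (f (g t)))\<^sup>2)"
    proof (rule set_integrable_bound)
      show "set_integrable lborel {a..b} (\<lambda>t. K\<^sup>2 * (norm (g t))\<^sup>2)"
        using u by (auto simp: has_weak_deriv_def)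
      show "AE t in lborel. t \<in> {a..b} \<longrightarrow> norm ((norm (f (g t)))\<^sup>2) \<le> norm (K\<^sup>2 * (norm (g t))\<^sup>2)"
        using power_mono[OF K, of _ 2] by (simp add: power_mult_distrib mult.commute)
    qed (simp add: set_borel_measurable_def)
    assume "a \<le> b"
    then have "f (u b) - f (u a) = f (LBINT t:{a..b}. g t)"
      using u by (simp add: has_weak_deriv_def bounded_linear.linear[OF f] linear_diff[symmetric])
    also have "\<dots> = (LBINT t:{a..b}. f (g t))"
      using integral_bounded_linear[OF f has_weak_deriv_set_integrable[OF u, of a b, unfolded set_integrable_def]]
      by (simp add: set_lebesgue_integral_def linear_scale[OF bounded_linear.linear[OF f]])
    finally show "f (u b) - f (u a) = (LBINT t:{a..b}. f (g t))" .
  qed simp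
qed

lemma has_weak_deriv_add:
  assumes u: "has_weak_deriv u g" and v: "has_weak_deriv v h"
  shows "has_weak_deriv (\<lambda>t. u t + v t) (\<lambda>t. g t + h t)"
proof -
  have [measurable]: "g \<in> borel_measurable borel" "h \<in> borel_measurable borel"
    using u v by (auto intro: has_weak_deriv_measurable)
  show ?thesis
    unfolding has_weak_deriv_def
  proof (intro conjI allI impI)
    fix a b :: real
    show "set_integrable lborel {a..b} (\<lambda>t. (norm (g t + h t))\<^sup>2)"
    proof (rule set_integrable_bound)
      show "set_integrable lborel {a..b} (\<lambda>t. 2 * (norm (g t))\<^sup>2 + 2 * (norm (h t))\<^sup>2)"
        using u v by (intro set_integral_add) (auto simp: has_weak_deriv_def)
      have "(norm (x + y))\<^sup>2 \<le> 2 * (norm x)\<^sup>2 + 2 * (norm y)\<^sup>2" for x y :: 'a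
      proof -
        have "(norm (x + y))\<^sup>2 \<le> (norm x + norm y)\<^sup>2" by (intro power_mono norm_triangle_ineq) simp
        also have "\<dots> \<le> 2 * (norm x)\<^sup>2 + 2 * (norm y)\<^sup>2"
          using zero_le_power2[of "norm x - norm y"] by (simp add: power2_eq_square algebra_simps)
        finally show ?thesis .
      qed
      then show "AE t in lborel. t \<in> {a..b} \<longrightarrow> norm ((norm (g t + h t))\<^sup>2) \<le> norm (2 * (norm (g t))\<^sup>2 + 2 * (norm (h t))\<^sup>2)"
        by simp
    qed (simp add: set_borel_measurable_def)
    assume "a \<le> b"
    then show "u b + v b - (u a + v a) = (LBINT t:{a..b}. g t + h t)"
      using u v has_weak_deriv_set_integrable[OF u, of a b] has_weak_deriv_set_integrable[OF v, of a b]
      by (subst set_integral_add) (auto simp: has_weak_deriv_def algebra_simps)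
  qed simp
qed

lemma has_weak_deriv_continuous:
  assumes u: "has_weak_deriv u g"
  shows "continuous_on UNIV u"
proof -
  have "continuous_on {-R..R} u" for R :: real
  proof (cases "0 \<le> R")
    case True
    have int: "g integrable_on {a..b}" "integral {a..b} g = (LBINT t:{a..b}. g t)" for a b
      using set_borel_integral_eq_integral[OF has_weak_deriv_set_integrable[OF u, of a b]] by auto
    have "continuous_on {-R..R} (\<lambda>s. u (-R) + integral {-R..s} g)"
      using int by (intro continuous_intros indefinite_integral_continuous_1)
    moreover have "u (-R) + integral {-R..s} g = u s" if "s \<in> {-R..R}" for s
      using u that unfolding int by (auto simp: has_weak_deriv_def) (metis add.commute diff_add_cancel)
    ultimately show ?thesis by (rule continuous_on_eq)
  qed simp
  then have "isCont u t" for t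
    by (rule continuous_on_interior[of "{-(\<bar>t\<bar>+1)..\<bar>t\<bar>+1}" u t]) auto
  then show ?thesis by (simp add: continuous_at_imp_continuous_on)
qed

text \<open>The substitution by an isometry t \<mapsto> e (t - c) of the line. The end points of the new interval
  are exchanged if e = -1, which min and max account for.\<close>

lemma set_integral_isometry:
  fixes f :: "real \<Rightarrow> 'a::euclidean_space" and a b c e :: real
  assumes e: "e \<in> {1, -1}" and "a \<le> b"
  defines "J \<equiv> {min (e * (a - c)) (e * (b - c))..max (e * (a - c)) (e * (b - c))}"
  shows "set_integrable lborel {a..b} (\<lambda>t. f (e * (t - c))) \<longleftrightarrow> set_integrable lborel J f"
    and "(LBINT t:{a..b}. f (e * (t - c))) = (LBINT t:J. f t)"
proof -
  have ind: "(indicator {a..b} t :: real) = indicator J (- (e * c) + e * t)" for t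
    using assms by (auto simp: indicator_def)
  have arg: "e * (t - c) = - (e * c) + e * t" for t by (simp add: algebra_simps)
  have e0: "e \<noteq> 0" "\<bar>e\<bar> = 1" using e by auto
  show "set_integrable lborel {a..b} (\<lambda>t. f (e * (t - c))) \<longleftrightarrow> set_integrable lborel J f"
    unfolding set_integrable_def ind arg
    using lborel_integrable_real_affine_iff[OF e0(1), of "\<lambda>s. indicator J s *\<^sub>R f s" "- (e * c)"] by simp
  show "(LBINT t:{a..b}. f (e * (t - c))) = (LBINT t:J. f t)"
    unfolding set_lebesgue_integral_def ind arg
    using lborel_integral_real_affine[OF e0(1), of "\<lambda>s. indicator J s *\<^sub>R f s" "- (e * c)"] e0 by simp
qed

lemma has_weak_deriv_isometry:
  fixes u :: "real \<Rightarrow> 'a::euclidean_space"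
  assumes e: "e \<in> {1, -1}" and u: "has_weak_deriv u g"
  shows "has_weak_deriv (\<lambda>t. u (e * (t - c))) (\<lambda>t. e *\<^sub>R g (e * (t - c)))"
proof -
  have [measurable]: "g \<in> borel_measurable borel" using u by (rule has_weak_deriv_measurable)
  show ?thesis
    unfolding has_weak_deriv_def
  proof (intro conjI allI impI)
    fix a b :: real
    have e1: "\<bar>e\<bar> = 1" using e by auto
    show "set_integrable lborel {a..b} (\<lambda>t. (norm (e *\<^sub>R g (e * (t - c))))\<^sup>2)"
    proof (cases "a \<le> b")
      case True
      show ?thesis
        using set_integral_isometry(1)[OF e True, of "\<lambda>t. (norm (g t))\<^sup>2" c] u e1
        by (simp add: has_weak_deriv_def)
    qed (simp add: set_integrable_def)
    assume ab: "a \<le> b"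
    have "(LBINT t:{a..b}. e *\<^sub>R g (e * (t - c))) = e *\<^sub>R (LBINT t:{a..b}. g (e * (t - c)))"
      by simp
    also have "\<dots> = u (e * (b - c)) - u (e * (a - c))"
    proof -
      have inc: "(LBINT t:{p..q}. g t) = u q - u p" if "p \<le> q" for p q
        using u that by (simp add: has_weak_deriv_def)
      show ?thesis
        unfolding set_integral_isometry(2)[OF e ab] using e ab by (auto simp: inc)
    qed
    finally show "u (e * (b - c)) - u (e * (a - c)) = (LBINT t:{a..b}. e *\<^sub>R g (e * (t - c)))" ..
  qed simp
qed

lemma weak_deriv_has_weak_deriv: "u \<in> W12_loc \<Longrightarrow> has_weak_deriv u (weak_deriv u)"
  unfolding W12_loc_def weak_deriv_def using someI_ex[of "has_weak_deriv u"] by blast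

section \<open>Complex loops\<close>

lemma Re_cmat_mult: "Re ((cmat A *v z) $ i) = (A *v (\<chi> i. Re (z $ i))) $ i"
  by (simp add: cmat_def map_matrix_def matrix_vector_mult_def)

lemma Im_cmat_mult: "Im ((cmat A *v z) $ i) = (A *v (\<chi> i. Im (z $ i))) $ i"
  by (simp add: cmat_def map_matrix_def matrix_vector_mult_def)

lemma W12_loc_complex_iff:
  fixes u :: "real \<Rightarrow> complex^'m"
  shows "u \<in> W12_loc \<longleftrightarrow>
    (\<lambda>t. \<chi> i. Re (u t $ i)) \<in> W12_loc \<and> (\<lambda>t. \<chi> i. Im (u t $ i)) \<in> W12_loc"
proof
  assume "u \<in> W12_loc"
  then obtain g where g: "has_weak_deriv u g" by (auto simp: W12_loc_def)
  have "bounded_linear (\<lambda>z::complex^'m. \<chi> i. Re (z $ i))" "bounded_linear (\<lambda>z::complex^'m. \<chi> i. Im (z $ i))"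
    unfolding linear_conv_bounded_linear[symmetric] by (auto intro!: linearI simp: vec_eq_iff)
  from this[THEN has_weak_deriv_bounded_linear, OF g]
  show "(\<lambda>t. \<chi> i. Re (u t $ i)) \<in> W12_loc \<and> (\<lambda>t. \<chi> i. Im (u t $ i)) \<in> W12_loc"
    by (auto simp: W12_loc_def)
next
  assume "(\<lambda>t. \<chi> i. Re (u t $ i)) \<in> W12_loc \<and> (\<lambda>t. \<chi> i. Im (u t $ i)) \<in> W12_loc"
  then obtain g h where gh: "has_weak_deriv (\<lambda>t. \<chi> i. Re (u t $ i)) g" "has_weak_deriv (\<lambda>t. \<chi> i. Im (u t $ i)) h"
    by (auto simp: W12_loc_def)
  have "bounded_linear (\<lambda>z::real^'m. \<chi> i. complex_of_real (z $ i))"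
    "bounded_linear (\<lambda>z::real^'m. \<chi> i. \<i> * complex_of_real (z $ i))"
    unfolding linear_conv_bounded_linear[symmetric]
    by (auto intro!: linearI simp: vec_eq_iff algebra_simps) (simp_all add: scaleR_conv_of_real)
  from has_weak_deriv_add[OF has_weak_deriv_bounded_linear[OF this(1) gh(1)]
      has_weak_deriv_bounded_linear[OF this(2) gh(2)]]
  have "has_weak_deriv (\<lambda>t. (\<chi> i. complex_of_real (Re (u t $ i))) + (\<chi> i. \<i> * complex_of_real (Im (u t $ i))))
      (\<lambda>t. (\<chi> i. complex_of_real (g t $ i)) + (\<chi> i. \<i> * complex_of_real (h t $ i)))"
    by simp
  moreover have "(\<chi> i. complex_of_real (Re (u t $ i))) + (\<chi> i. \<i> * complex_of_real (Im (u t $ i))) = u t" for t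
    by (simp add: vec_eq_iff complex_eq_iff)
  ultimately show "u \<in> W12_loc" by (auto simp: W12_loc_def)
qed

text \<open>Real and imaginary parts can be treated together, since the matrix is real.\<close>

lemma E_cplx_iff:
  "u \<in> E_cplx T Q \<longleftrightarrow> u \<in> W12_loc \<and> (\<forall>t. u t = cmat Q *v u (t + T))"
proof -
  have "u t = cmat Q *v u (t + T) \<longleftrightarrow>
      (\<chi> i. Re (u t $ i)) = Q *v (\<chi> i. Re (u (t + T) $ i)) \<and>
      (\<chi> i. Im (u t $ i)) = Q *v (\<chi> i. Im (u (t + T) $ i))" for t
    by (auto simp: vec_eq_iff complex_eq_iff Re_cmat_mult Im_cmat_mult)
  then show ?thesis
    unfolding E_cplx_def E_real_def W12_loc_complex_iff by auto
qed

section \<open>The Hessian of the Lagrangian\<close>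

text \<open>The chain rule for an affine map, applied twice. Affinity is what keeps second derivatives of the map
  out of the formula.\<close>

lemma second_derivative_affine_pullback:
  fixes F :: "'a::real_normed_vector \<Rightarrow> real"
    and f' :: "'a \<Rightarrow> 'a \<Rightarrow>\<^sub>L real" and D :: "'a \<Rightarrow> 'a \<Rightarrow>\<^sub>L ('a \<Rightarrow>\<^sub>L real)"
  assumes f': "\<And>p. (F has_derivative blinfun_apply (f' p)) (at p)"
    and D: "\<And>p. (f' has_derivative blinfun_apply (D p)) (at p)"
    and A: "bounded_linear A" and inv: "\<And>p. F p = F (c + A p)"
  shows "D p a b = D (c + A p) (A a) (A b)"
proof -
  have \<Psi>: "((\<lambda>p. c + A p) has_derivative A) (at p)" for p
    using bounded_linear_imp_has_derivative[OF A] by (auto intro!: derivative_eq_intros)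
  have first: "f' p b = f' (c + A p) (A b)" for p b
  proof -
    have "((\<lambda>p. F (c + A p)) has_derivative (\<lambda>b. f' (c + A p) (A b))) (at p)"
      using has_derivative_compose[OF \<Psi> f'] .
    then have "(F has_derivative (\<lambda>b. f' (c + A p) (A b))) (at p)"
      unfolding inv[symmetric] .
    from has_derivative_unique[OF this f'] show ?thesis by (metis)
  qed
  have app: "((\<lambda>p. f' p b) has_derivative (\<lambda>a. D p a b)) (at p)" for p b
    using bounded_linear.has_derivative[OF blinfun.bounded_linear_left D] .
  have "((\<lambda>p. f' (c + A p) (A b)) has_derivative (\<lambda>a. D (c + A p) (A a) (A b))) (at p)"
    using has_derivative_compose[OF \<Psi> app] .
  then have "((\<lambda>p. f' p b) has_derivative (\<lambda>a. D (c + A p) (A a) (A b))) (at p)"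
    unfolding first[symmetric] .
  from has_derivative_unique[OF this app] show ?thesis by metis
qed

lemma partial_eq_derivative:
  assumes "(f has_derivative f') (at q)"
  shows "partial i f q = f' (axis i 1)"
  using frechet_derivative_at[OF assms] by (simp add: partial_def)

text \<open>The blocks of the Hessian are values of one continuous bilinear form, so that continuity and
  covariance have to be proved only once, for the full second derivative.\<close>

lemma C2_hessians:
  fixes L :: "real \<Rightarrow> real^'m \<Rightarrow> real^'m \<Rightarrow> real"
    and f' :: "real \<times> (real^'m) \<times> (real^'m) \<Rightarrow> (real \<times> (real^'m) \<times> (real^'m)) \<Rightarrow>\<^sub>L real"
    and D :: "real \<times> (real^'m) \<times> (real^'m) \<Rightarrow> (real \<times> (real^'m) \<times> (real^'m)) \<Rightarrow>\<^sub>L ((real \<times> (real^'m) \<times> (real^'m)) \<Rightarrow>\<^sub>L real)"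
  assumes f': "\<And>p. ((\<lambda>(t, q, v). L t q v) has_derivative blinfun_apply (f' p)) (at p)"
    and D: "\<And>p. (f' has_derivative blinfun_apply (D p)) (at p)"
  shows "hess_vv L t q v $ i $ j = D (t, q, v) (0, 0, axis i 1) (0, 0, axis j 1)"
    and "hess_vx L t q v $ i $ j = D (t, q, v) (0, 0, axis i 1) (0, axis j 1, 0)"
    and "hess_xx L t q v $ i $ j = D (t, q, v) (0, axis i 1, 0) (0, axis j 1, 0)"
proof -
  have inc_v: "((\<lambda>w. (t, q, w)) has_derivative (\<lambda>d. (0, 0, d))) (at v)" for q v :: "real^'m"
    by (auto intro!: derivative_eq_intros)
  have inc_x: "((\<lambda>y. (t, y, v)) has_derivative (\<lambda>d. (0, d, 0))) (at q)" for q v :: "real^'m"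
    by (auto intro!: derivative_eq_intros)
  have app: "((\<lambda>p. f' p b) has_derivative (\<lambda>a. D p a b)) (at p)" for p b
    using bounded_linear.has_derivative[OF blinfun.bounded_linear_left D] .
  have dv: "partial j (\<lambda>z. L t q z) w = f' (t, q, w) (0, 0, axis j 1)" for q w j
    using has_derivative_compose[OF inc_v f', of q w] by (intro partial_eq_derivative) simp
  have dx: "partial j (\<lambda>y. L t y w) q = f' (t, q, w) (0, axis j 1, 0)" for q w j
    using has_derivative_compose[OF inc_x f', of w q] by (intro partial_eq_derivative) simp
  show "hess_vv L t q v $ i $ j = D (t, q, v) (0, 0, axis i 1) (0, 0, axis j 1)"
    unfolding hess_vv_def dv using partial_eq_derivative[OF has_derivative_compose[OF inc_v app]] by simp
  show "hess_vx L t q v $ i $ j = D (t, q, v) (0, 0, axis i 1) (0, axis j 1, 0)"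
    unfolding hess_vx_def dx using partial_eq_derivative[OF has_derivative_compose[OF inc_v app]] by simp
  show "hess_xx L t q v $ i $ j = D (t, q, v) (0, axis i 1, 0) (0, axis j 1, 0)"
    unfolding hess_xx_def dx using partial_eq_derivative[OF has_derivative_compose[OF inc_x app]] by simp
qed

lemma bilinear_eq_inner_matrix:
  fixes \<beta> :: "real^'m \<Rightarrow> real^'m \<Rightarrow> real" and M :: "real^'m^'m"
  assumes "bilinear \<beta>" and "\<And>i j. M $ i $ j = \<beta> (axis i 1) (axis j 1)"
  shows "\<beta> a b = a \<bullet> (M *v b)"
proof -
  have "\<beta> a b = \<beta> (\<Sum>i\<in>UNIV. a $ i *\<^sub>R axis i 1) (\<Sum>j\<in>UNIV. b $ j *\<^sub>R axis j 1)"
    using basis_expansion[of a] basis_expansion[of b] by (simp add: scalar_mult_eq_scaleR)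
  also have "\<dots> = (\<Sum>i\<in>UNIV. \<Sum>j\<in>UNIV. a $ i * (b $ j * M $ i $ j))"
    using assms
    by (simp add: bilinear_sum bilinear_lmul bilinear_rmul sum.cartesian_product)
  also have "\<dots> = a \<bullet> (M *v b)"
    by (simp add: inner_vec_def matrix_vector_mult_def sum_distrib_left mult.commute mult.left_commute)
  finally show ?thesis .
qed

lemma matrix_eq_if_inner_eq:
  fixes M M' :: "real^'m^'m"
  assumes "\<And>a b. a \<bullet> (M *v b) = a \<bullet> (M' *v b)"
  shows "M = M'"
  using assms by (metis matrix_eq vector_eq_rdot inner_commute)

lemma pullback_matrix:
  fixes \<beta> \<beta>' :: "real^'m \<Rightarrow> real^'m \<Rightarrow> real" and A M M' :: "real^'m^'m"
  assumes "bilinear \<beta>" "\<And>i j. M $ i $ j = \<beta> (axis i 1) (axis j 1)"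
    and "bilinear \<beta>'" "\<And>i j. M' $ i $ j = \<beta>' (axis i 1) (axis j 1)"
    and "\<And>a b. \<beta> a b = k * \<beta>' (A *v a) (A *v b)"
  shows "M = k *\<^sub>R (transpose A ** M' ** A)"
proof (rule matrix_eq_if_inner_eq)
  fix a b
  have "a \<bullet> (M *v b) = k * ((A *v a) \<bullet> (M' *v (A *v b)))"
    using bilinear_eq_inner_matrix[OF assms(1,2)] bilinear_eq_inner_matrix[OF assms(3,4)] assms(5) by metis
  also have "\<dots> = a \<bullet> ((k *\<^sub>R (transpose A ** M' ** A)) *v b)"
  proof -
    have "a \<bullet> (transpose A *v w) = (A *v a) \<bullet> w" for w
      by (metis dot_lmul_matrix inner_commute transpose_matrix_vector)
    then show ?thesis
      by (simp only: scaleR_matrix_vector_assoc[symmetric] inner_scaleR_right matrix_vector_mul_assoc[symmetric])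
  qed
  finally show "a \<bullet> (M *v b) = a \<bullet> ((k *\<^sub>R (transpose A ** M' ** A)) *v b)" .
qed

text \<open>For e = -1 time is reversed, and velocities change sign. The symmetries of the Lagrangian under
  S, N and Q are all of this form.\<close>

definition twist_symmetric :: "(real \<Rightarrow> real^'m \<Rightarrow> real^'m \<Rightarrow> real) \<Rightarrow> real \<Rightarrow> real \<Rightarrow> real^'m^'m \<Rightarrow> bool" where
  "twist_symmetric L e c A \<longleftrightarrow> (\<forall>t q v. L t q v = L (c + e * t) (A *v q) (e *\<^sub>R (A *v v)))"

text \<open>Each of the two arguments v contributes a factor e, so the signs cancel in the pure blocks and one
  remains in the mixed block.\<close>

lemma hessians_twist:
  fixes L :: "real \<Rightarrow> real^'m \<Rightarrow> real^'m \<Rightarrow> real"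
  assumes C2: "C2 (\<lambda>(t, q, v). L t q v)" and e: "e \<in> {1, -1}"
    and L: "twist_symmetric L e c A"
  shows "hess_vv L t q v = transpose A ** hess_vv L (c + e * t) (A *v q) (e *\<^sub>R (A *v v)) ** A"
    and "hess_vx L t q v = e *\<^sub>R (transpose A ** hess_vx L (c + e * t) (A *v q) (e *\<^sub>R (A *v v)) ** A)"
    and "hess_xx L t q v = transpose A ** hess_xx L (c + e * t) (A *v q) (e *\<^sub>R (A *v v)) ** A"
proof -
  obtain f' :: "real \<times> (real^'m) \<times> (real^'m) \<Rightarrow> (real \<times> (real^'m) \<times> (real^'m)) \<Rightarrow>\<^sub>L real"
    and D :: "real \<times> (real^'m) \<times> (real^'m) \<Rightarrow> (real \<times> (real^'m) \<times> (real^'m)) \<Rightarrow>\<^sub>L ((real \<times> (real^'m) \<times> (real^'m)) \<Rightarrow>\<^sub>L real)"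
    where f': "\<And>p. ((\<lambda>(t, q, v). L t q v) has_derivative blinfun_apply (f' p)) (at p)"
      and D: "\<And>p. (f' has_derivative blinfun_apply (D p)) (at p)"
    using C2 unfolding C2_def by blast
  define \<A> :: "real \<times> (real^'m) \<times> (real^'m) \<Rightarrow> real \<times> (real^'m) \<times> (real^'m)"
    where "\<A> = (\<lambda>(t, q, v). (e * t, A *v q, e *\<^sub>R (A *v v)))"
  have "bounded_linear \<A>"
    unfolding linear_conv_bounded_linear[symmetric] \<A>_def
    by (rule linearI) (auto simp: matrix_vector_right_distrib algebra_simps)
  note pull = second_derivative_affine_pullback[OF f' D this, of "(c, 0, 0)"]
  have inv: "(\<lambda>(t, q, v). L t q v) p = (\<lambda>(t, q, v). L t q v) ((c, 0, 0) + \<A> p)" for p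
    using L by (auto simp: \<A>_def twist_symmetric_def split: prod.split)
  have D_pull: "D (t, q, v) a b = D (c + e * t, A *v q, e *\<^sub>R (A *v v)) (\<A> a) (\<A> b)" for a b
    using pull[OF inv, of "(t, q, v)" a b] by (simp add: \<A>_def del: split_paired_All)
  have bilin: "bilinear (\<lambda>a b. D p (0, 0, a) (0, 0, b))" "bilinear (\<lambda>a b. D p (0, 0, a) (0, b, 0))"
    "bilinear (\<lambda>a b. D p (0, a, 0) (0, b, 0))" for p
  proof -
    define \<iota>\<^sub>v \<iota>\<^sub>x :: "real^'m \<Rightarrow> real \<times> (real^'m) \<times> (real^'m)"
      where "\<iota>\<^sub>v a = (0, 0, a)" and "\<iota>\<^sub>x a = (0, a, 0)" for a
    have lin: "\<iota>\<^sub>v (a + b) = \<iota>\<^sub>v a + \<iota>\<^sub>v b" "\<iota>\<^sub>x (a + b) = \<iota>\<^sub>x a + \<iota>\<^sub>x b"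
      "\<iota>\<^sub>v (r *\<^sub>R a) = r *\<^sub>R \<iota>\<^sub>v a" "\<iota>\<^sub>x (r *\<^sub>R a) = r *\<^sub>R \<iota>\<^sub>x a" for a b r
      by (simp_all add: \<iota>\<^sub>v_def \<iota>\<^sub>x_def)
    show "bilinear (\<lambda>a b. D p (0, 0, a) (0, 0, b))" "bilinear (\<lambda>a b. D p (0, 0, a) (0, b, 0))"
      "bilinear (\<lambda>a b. D p (0, a, 0) (0, b, 0))"
      unfolding \<iota>\<^sub>v_def[symmetric] \<iota>\<^sub>x_def[symmetric] bilinear_def
      by (auto intro!: linearI simp: lin blinfun.add_left blinfun.add_right
          blinfun.scaleR_left blinfun.scaleR_right)
  qed
  have ee: "e * e = 1" using e by auto
  have \<A>_v: "\<A> (0, 0, a) = e *\<^sub>R (0, 0, A *v a)" and \<A>_x: "\<A> (0, a, 0) = (0, A *v a, 0)" for a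
    by (simp_all add: \<A>_def)
  let ?p = "(c + e * t, A *v q, e *\<^sub>R (A *v v))"
  have "D (t, q, v) (0, 0, a) (0, 0, b) = 1 * D ?p (0, 0, A *v a) (0, 0, A *v b)" for a b
    unfolding D_pull \<A>_v using ee
    by (simp add: blinfun.scaleR_left blinfun.scaleR_right mult.assoc[symmetric] del: scaleR_Pair)
  from pullback_matrix[OF bilin(1) C2_hessians(1)[OF f' D] bilin(1) C2_hessians(1)[OF f' D] this]
  show "hess_vv L t q v = transpose A ** hess_vv L (c + e * t) (A *v q) (e *\<^sub>R (A *v v)) ** A"
    by simp
  have "D (t, q, v) (0, 0, a) (0, b, 0) = e * D ?p (0, 0, A *v a) (0, A *v b, 0)" for a b
    unfolding D_pull \<A>_v \<A>_x
    by (simp add: blinfun.scaleR_left blinfun.scaleR_right del: scaleR_Pair)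
  from pullback_matrix[OF bilin(2) C2_hessians(2)[OF f' D] bilin(2) C2_hessians(2)[OF f' D] this]
  show "hess_vx L t q v = e *\<^sub>R (transpose A ** hess_vx L (c + e * t) (A *v q) (e *\<^sub>R (A *v v)) ** A)" .
  have "D (t, q, v) (0, a, 0) (0, b, 0) = 1 * D ?p (0, A *v a, 0) (0, A *v b, 0)" for a b
    unfolding D_pull \<A>_x by simp
  from pullback_matrix[OF bilin(3) C2_hessians(3)[OF f' D] bilin(3) C2_hessians(3)[OF f' D] this]
  show "hess_xx L t q v = transpose A ** hess_xx L (c + e * t) (A *v q) (e *\<^sub>R (A *v v)) ** A"
    by simp
qed

lemma continuous_hessians:
  fixes L :: "real \<Rightarrow> real^'m \<Rightarrow> real^'m \<Rightarrow> real"
  assumes C2: "C2 (\<lambda>(t, q, v). L t q v)"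
    and q: "continuous_on UNIV q" and v: "continuous_on UNIV v"
  shows "continuous_on UNIV (\<lambda>t. hess_vv L t (q t) (v t) $ i $ j)"
    and "continuous_on UNIV (\<lambda>t. hess_vx L t (q t) (v t) $ i $ j)"
    and "continuous_on UNIV (\<lambda>t. hess_xx L t (q t) (v t) $ i $ j)"
proof -
  obtain f' :: "real \<times> (real^'m) \<times> (real^'m) \<Rightarrow> (real \<times> (real^'m) \<times> (real^'m)) \<Rightarrow>\<^sub>L real"
    and D :: "real \<times> (real^'m) \<times> (real^'m) \<Rightarrow> (real \<times> (real^'m) \<times> (real^'m)) \<Rightarrow>\<^sub>L ((real \<times> (real^'m) \<times> (real^'m)) \<Rightarrow>\<^sub>L real)"
    where f': "\<And>p. ((\<lambda>(t, q, v). L t q v) has_derivative blinfun_apply (f' p)) (at p)"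
      and D: "\<And>p. (f' has_derivative blinfun_apply (D p)) (at p)"
      and cont: "continuous_on UNIV D"
    using C2 unfolding C2_def by blast
  have "continuous_on UNIV (\<lambda>t. (t, q t, v t))" using q v by (intro continuous_intros)
  then have D_cont: "continuous_on UNIV (\<lambda>t. D (t, q t, v t))"
    using continuous_on_compose2[OF cont] by auto
  show "continuous_on UNIV (\<lambda>t. hess_vv L t (q t) (v t) $ i $ j)"
    "continuous_on UNIV (\<lambda>t. hess_vx L t (q t) (v t) $ i $ j)"
    "continuous_on UNIV (\<lambda>t. hess_xx L t (q t) (v t) $ i $ j)"
    unfolding C2_hessians[OF f' D] by (intro continuous_intros D_cont)+
qed

section \<open>The Hermitian product and complexified matrices\<close>

lemma herm_add_left: "herm (a + b) c = herm a c + herm b c"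
  by (simp add: herm_def sum.distrib algebra_simps)

lemma herm_add_right: "herm a (b + c) = herm a b + herm a c"
  by (simp add: herm_def sum.distrib algebra_simps)

lemma herm_scale_left: "herm (k *s a) b = k * herm a b"
  by (simp add: herm_def sum_distrib_left mult.assoc)

lemma herm_scale_right: "herm a (k *s b) = cnj k * herm a b"
  by (simp add: herm_def sum_distrib_left mult.assoc mult.left_commute)

lemma scaleR_eq_of_real_scale: "r *\<^sub>R (a :: complex^'m) = of_real r *s a"
  unfolding vec_eq_iff vector_scaleR_component vector_smult_component
  by (simp add: scaleR_conv_of_real)

lemma cmat_mult: "cmat (A ** C) = cmat A ** cmat C"
  by (simp add: cmat_def map_matrix_def matrix_matrix_mult_def vec_eq_iff)

lemma cmat_transpose: "cmat (transpose A) = transpose (cmat A)"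
  by (simp add: cmat_def map_matrix_def transpose_def vec_eq_iff)

lemma cmat_one: "cmat (mat 1) = mat 1"
  by (simp add: cmat_def map_matrix_def mat_def vec_eq_iff)

lemma cmat_scaleR_vector: "cmat (r *\<^sub>R A) *v a = of_real r *s (cmat A *v a)"
  by (simp add: cmat_def map_matrix_def matrix_vector_mult_def vec_eq_iff sum_distrib_left mult.assoc)

lemma cmat_vector_scale: "cmat A *v (k *s a) = k *s (cmat A *v a)"
  by (simp add: matrix_vector_mult_def vec_eq_iff sum_distrib_left mult.left_commute)

lemma bounded_linear_cmat: "bounded_linear (\<lambda>a. cmat A *v a)"
  unfolding linear_conv_bounded_linear[symmetric]
  by (rule linearI) (simp_all add: matrix_vector_right_distrib scaleR_eq_of_real_scale cmat_vector_scale)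

lemma herm_cmat: "herm (cmat M *v a) b = (\<Sum>i\<in>UNIV. \<Sum>j\<in>UNIV. of_real (M $ i $ j) * a $ j * cnj (b $ i))"
  by (simp add: herm_def cmat_def map_matrix_def matrix_vector_mult_def sum_distrib_right)

lemma herm_cmat_transpose: "herm (cmat (transpose A) *v a) b = herm a (cmat A *v b)"
  unfolding herm_cmat
  by (subst sum.swap)
    (simp add: herm_def cmat_def map_matrix_def matrix_vector_mult_def transpose_def
      sum_distrib_left mult.commute mult.left_commute)

section \<open>Index forms with continuous coefficients\<close>

definition locally_L2 :: "(real \<Rightarrow> 'a::euclidean_space) \<Rightarrow> bool" where
  "locally_L2 f \<longleftrightarrow> f \<in> borel_measurable borel \<and> (\<forall>a b. set_integrable lborel {a..b} (\<lambda>t. (norm (f t))\<^sup>2))"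

lemma has_weak_deriv_locally_L2:
  assumes "has_weak_deriv u g"
  shows "locally_L2 u" "locally_L2 g"
proof -
  show "locally_L2 g" using assms by (auto simp: has_weak_deriv_def locally_L2_def)
  have cont: "continuous_on UNIV u" using assms by (rule has_weak_deriv_continuous)
  have "set_integrable lborel {a..b} (\<lambda>t. (norm (u t))\<^sup>2)" for a b
    by (intro borel_integrable_atLeastAtMost' continuous_intros continuous_on_subset[OF cont]) simp
  then show "locally_L2 u" using cont by (auto simp: locally_L2_def intro: borel_measurable_continuous_onI)
qed

lemma set_integrable_weighted_product:
  fixes c :: "real \<Rightarrow> real" and f g :: "real \<Rightarrow> complex^'m"
  assumes c: "continuous_on UNIV c" and f: "locally_L2 f" and g: "locally_L2 g"
  shows "set_integrable lborel {a..b} (\<lambda>t. of_real (c t) * f t $ j * cnj (g t $ i))"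
proof -
  have [measurable]: "f \<in> borel_measurable borel" "g \<in> borel_measurable borel"
    using f g by (auto simp: locally_L2_def)
  have [measurable]: "c \<in> borel_measurable borel" using c by (rule borel_measurable_continuous_onI)
  have nth[measurable]: "(\<lambda>z::complex^'m. z $ i) \<in> borel_measurable borel" for i
    by (intro borel_measurable_continuous_onI continuous_intros)
  have "bounded (c ` {a..b})"
    by (intro compact_imp_bounded compact_continuous_image continuous_on_subset[OF c]) auto
  then obtain K where "\<forall>t\<in>{a..b}. \<bar>c t\<bar> \<le> K" by (auto simp: bounded_iff)
  then have K: "\<And>t. t \<in> {a..b} \<Longrightarrow> \<bar>c t\<bar> \<le> K" by blast
  show ?thesis
  proof (rule set_integrable_bound)
    show "set_integrable lborel {a..b} (\<lambda>t. K * ((norm (f t))\<^sup>2 + (norm (g t))\<^sup>2))"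
      using f g by (intro set_integrable_mult_right set_integral_add) (auto simp: locally_L2_def)
    have "(\<lambda>z::complex^'m. cnj (z $ i)) \<in> borel_measurable borel"
      by (intro borel_measurable_continuous_onI continuous_intros)
    from measurable_compose[OF _ this, of g] measurable_compose[OF _ nth, of f borel j]
    have "(\<lambda>t. f t $ j) \<in> borel_measurable borel" "(\<lambda>t. cnj (g t $ i)) \<in> borel_measurable borel"
      by measurable
    then show "set_borel_measurable lborel {a..b} (\<lambda>t. of_real (c t) * f t $ j * cnj (g t $ i))"
      unfolding set_borel_measurable_def by measurable
    have bound: "norm (of_real (c t) * f t $ j * cnj (g t $ i)) \<le> K * ((norm (f t))\<^sup>2 + (norm (g t))\<^sup>2)"
      if t: "t \<in> {a..b}" for t
    proof -
      have K0: "0 \<le> K" using K[OF t] by linarith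
      have "norm (f t $ j) * norm (g t $ i) \<le> norm (f t) * norm (g t)"
        by (intro mult_mono Finite_Cartesian_Product.norm_nth_le) auto
      also have "\<dots> \<le> (norm (f t))\<^sup>2 + (norm (g t))\<^sup>2"
        using sum_squares_bound[of "norm (f t)" "norm (g t)"] mult_nonneg_nonneg[of "norm (f t)" "norm (g t)"]
        by (simp del: mult_nonneg_nonneg)
      finally have "\<bar>c t\<bar> * (norm (f t $ j) * norm (g t $ i)) \<le> K * ((norm (f t))\<^sup>2 + (norm (g t))\<^sup>2)"
        using K[OF t] K0 by (intro mult_mono) auto
      then show ?thesis by (simp add: norm_mult mult.assoc)
    qed
    show "AE t in lborel. t \<in> {a..b} \<longrightarrow> norm (of_real (c t) * f t $ j * cnj (g t $ i))
        \<le> norm (K * ((norm (f t))\<^sup>2 + (norm (g t))\<^sup>2))"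
    proof (intro AE_I2 impI)
      fix t assume "t \<in> {a..b}"
      from order_trans[OF bound[OF this] abs_ge_self]
      show "norm (of_real (c t) * f t $ j * cnj (g t $ i)) \<le> norm (K * ((norm (f t))\<^sup>2 + (norm (g t))\<^sup>2))"
        unfolding real_norm_def .
    qed
  qed
qed

lemma set_integrable_herm:
  fixes f g :: "real \<Rightarrow> complex^'m"
  assumes "\<And>i j. continuous_on UNIV (\<lambda>t. M t $ i $ j)" "locally_L2 f" "locally_L2 g"
  shows "set_integrable lborel {a..b} (\<lambda>t. herm (cmat (M t) *v f t) (g t))"
  using set_integrable_weighted_product[OF assms] unfolding herm_cmat set_integrable_def scaleR_sum_right
  by (intro Bochner_Integration.integrable_sum)

lemma set_integral_cong_AE_integrable:
  fixes f g :: "'a \<Rightarrow> 'b::euclidean_space"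
  assumes "set_integrable M A f" "set_integrable M A g" "AE t in M. f t = g t"
  shows "(LINT t:A|M. f t) = (LINT t:A|M. g t)"
  using assms unfolding set_lebesgue_integral_def set_integrable_def
  by (intro integral_cong_AE) (auto intro: borel_measurable_integrable)

lemma set_integral_combine:
  fixes f :: "real \<Rightarrow> complex"
  assumes "a \<le> b" "b \<le> c" and f: "\<And>a b. set_integrable lborel {a..b} f"
  shows "(LBINT t:{a..c}. f t) = (LBINT t:{a..b}. f t) + (LBINT t:{b..c}. f t)"
  using Henstock_Kurzweil_Integration.integral_combine[OF assms(1,2), of f]
    set_borel_integral_eq_integral[OF f] by simp

text \<open>Both intervals are completed to the interval between the extreme end points; the pieces
  added are translates of each other by T.\<close>

lemma periodic_set_integral:
  fixes f :: "real \<Rightarrow> complex"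
  assumes T: "T > 0" and f: "\<And>a b. set_integrable lborel {a..b} f"
    and per: "AE t in lborel. f (t + T) = f t"
  shows "(LBINT t:{a..a + T}. f t) = (LBINT t:{0..T}. f t)"
proof -
  have shift: "(LBINT t:{p + T..q + T}. f t) = (LBINT t:{p..q}. f t)" if "p \<le> q" for p q
  proof -
    have "(LBINT t:{p + T..q + T}. f t) = (LBINT t:{p..q}. f (t + T))"
      using set_integral_isometry(2)[of 1 p q f "- T"] that by simp
    also have "\<dots> = (LBINT t:{p..q}. f t)"
      using set_integral_isometry(1)[of 1 p q f "- T"] that f per
      by (intro set_integral_cong_AE_integrable) auto
    finally show ?thesis .
  qed
  show ?thesis
  proof (cases "0 \<le> a")
    case True
    then show ?thesis
      using set_integral_combine[of 0 a "a + T" f] set_integral_combine[of 0 T "a + T" f] shift[of 0 a] f T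
      by (simp add: add.commute)
  next
    case False
    then show ?thesis
      using set_integral_combine[of a 0 T f] set_integral_combine[of a "a + T" T f] shift[of a 0] f T
      by (simp add: add.commute)
  qed
qed

text \<open>The common shape of the actions of S and N on loops. It is chosen so that the value at
  c + e t is A applied to the value at t.\<close>

definition twist :: "real \<Rightarrow> real \<Rightarrow> real^'m^'m \<Rightarrow> (real \<Rightarrow> complex^'m) \<Rightarrow> real \<Rightarrow> complex^'m" where
  "twist e c A u = (\<lambda>t. cmat A *v u (e * (t - c)))"

lemma has_weak_deriv_twist:
  assumes "e \<in> {1, -1}" "has_weak_deriv u g"
  shows "has_weak_deriv (twist e c A u) (\<lambda>t. e *\<^sub>R twist e c A g t)"
  using has_weak_deriv_bounded_linear[OF bounded_linear_cmat has_weak_deriv_isometry[OF assms]]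
  by (simp add: twist_def scaleR_eq_of_real_scale cmat_vector_scale)

lemma has_weak_deriv_cscale:
  fixes u g :: "real \<Rightarrow> complex^'m"
  assumes "has_weak_deriv u g" shows "has_weak_deriv (cscale k u) (cscale k g)"
proof -
  have "bounded_linear (\<lambda>a :: complex^'m. k *s a)"
    unfolding linear_conv_bounded_linear[symmetric]
    by (rule linearI) (simp_all add: vec_eq_iff algebra_simps)
  from has_weak_deriv_bounded_linear[OF this assms] show ?thesis by (simp add: cscale_def)
qed

text \<open>The index form with its coefficients along the path as parameters. Continuity of the coefficients makes it
  finite on W^{1,2}: weak derivatives are locally square integrable, and loops are continuous.\<close>

locale continuous_coefficients =
  fixes P C R :: "real \<Rightarrow> real^'m^'m"
  assumes continuous_P: "continuous_on UNIV (\<lambda>t. P t $ i $ j)"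
    and continuous_C: "continuous_on UNIV (\<lambda>t. C t $ i $ j)"
    and continuous_R: "continuous_on UNIV (\<lambda>t. R t $ i $ j)"
begin

definition density where
  "density u g v h t = herm (cmat (P t) *v g t + cmat (C t) *v u t) (h t)
     + herm (transpose (cmat (C t)) *v g t) (v t) + herm (cmat (R t) *v u t) (v t)"

definition form where
  "form T u v = (LBINT t:{0..T}. density u (weak_deriv u) v (weak_deriv v) t)"

lemma density_integrable:
  assumes u: "has_weak_deriv u g" and v: "has_weak_deriv v h"
  shows "set_integrable lborel {a..b} (density u g v h)"
proof -
  have ct: "continuous_on UNIV (\<lambda>t. transpose (C t) $ i $ j)" for i j
    using continuous_C by (simp add: transpose_def)
  note L2 = has_weak_deriv_locally_L2[OF u] has_weak_deriv_locally_L2[OF v]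
  show ?thesis
    unfolding density_def herm_add_left cmat_transpose[symmetric]
    by (intro set_integral_add set_integrable_herm continuous_P continuous_C continuous_R ct L2)
qed

text \<open>Any weak derivatives may be used in place of the chosen ones. Sesquilinearity and
  invariance follow from it, as sums and twists of weak derivatives are weak derivatives again.\<close>

lemma form_eq:
  assumes u: "has_weak_deriv u g" and v: "has_weak_deriv v h"
  shows "form T u v = (LBINT t:{0..T}. density u g v h t)"
  unfolding form_def
proof (rule set_integral_cong_AE_integrable)
  have u': "has_weak_deriv u (weak_deriv u)" and v': "has_weak_deriv v (weak_deriv v)"
    using u v by (auto intro!: weak_deriv_has_weak_deriv simp: W12_loc_def)
  show "set_integrable lborel {0..T} (density u (weak_deriv u) v (weak_deriv v))"
    "set_integrable lborel {0..T} (density u g v h)"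
    by (rule density_integrable[OF u' v'] density_integrable[OF u v])+
  show "AE t in lborel. density u (weak_deriv u) v (weak_deriv v) t = density u g v h t"
    using has_weak_deriv_unique[OF u' u] has_weak_deriv_unique[OF v' v]
    by eventually_elim (simp add: density_def)
qed

lemma form_add_left:
  assumes "u \<in> W12_loc" "v \<in> W12_loc" "w \<in> W12_loc"
  shows "form T (u + v) w = form T u w + form T v w"
proof -
  note d = assms[THEN weak_deriv_has_weak_deriv]
  have uv: "has_weak_deriv (u + v) (weak_deriv u + weak_deriv v)"
    using has_weak_deriv_add[OF d(1,2)] by (simp add: plus_fun_def)
  have eq: "density (u + v) (weak_deriv u + weak_deriv v) w (weak_deriv w) t =
      density u (weak_deriv u) w (weak_deriv w) t + density v (weak_deriv v) w (weak_deriv w) t" for t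
    by (simp add: density_def herm_add_left matrix_vector_right_distrib plus_fun_apply)
  show ?thesis
    unfolding form_eq[OF uv d(3)] form_eq[OF d(1) d(3)] form_eq[OF d(2) d(3)]
      eq[abs_def] by (intro set_integral_add(2) density_integrable d)
qed

lemma form_add_right:
  assumes "u \<in> W12_loc" "v \<in> W12_loc" "w \<in> W12_loc"
  shows "form T w (u + v) = form T w u + form T w v"
proof -
  note d = assms[THEN weak_deriv_has_weak_deriv]
  have uv: "has_weak_deriv (u + v) (weak_deriv u + weak_deriv v)"
    using has_weak_deriv_add[OF d(1,2)] by (simp add: plus_fun_def)
  have eq: "density w (weak_deriv w) (u + v) (weak_deriv u + weak_deriv v) t =
      density w (weak_deriv w) u (weak_deriv u) t + density w (weak_deriv w) v (weak_deriv v) t" for t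
    by (simp add: density_def herm_add_left herm_add_right plus_fun_apply)
  show ?thesis
    unfolding form_eq[OF d(3) uv] form_eq[OF d(3) d(1)] form_eq[OF d(3) d(2)]
      eq[abs_def] by (intro set_integral_add(2) density_integrable d)
qed

lemma form_scale_left:
  assumes "u \<in> W12_loc" "w \<in> W12_loc"
  shows "form T (cscale k u) w = k * form T u w"
proof -
  note d = assms[THEN weak_deriv_has_weak_deriv]
  have eq: "density (cscale k u) (cscale k (weak_deriv u)) w (weak_deriv w) t = k * density u (weak_deriv u) w (weak_deriv w) t" for t
    by (simp add: density_def cscale_def cmat_vector_scale cmat_transpose[symmetric]
        herm_add_left herm_scale_left distrib_left)
  show ?thesis
    unfolding form_eq[OF has_weak_deriv_cscale[OF d(1)] d(2)] form_eq[OF d] eq by simp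
qed

lemma form_scale_right:
  assumes "u \<in> W12_loc" "w \<in> W12_loc"
  shows "form T w (cscale k u) = cnj k * form T w u"
proof -
  note d = assms[THEN weak_deriv_has_weak_deriv]
  have eq: "density w (weak_deriv w) (cscale k u) (cscale k (weak_deriv u)) t = cnj k * density w (weak_deriv w) u (weak_deriv u) t" for t
    by (simp add: density_def cscale_def herm_add_left herm_scale_right distrib_left)
  show ?thesis
    unfolding form_eq[OF d(2) has_weak_deriv_cscale[OF d(1)]] form_eq[OF d(2,1)] eq by simp
qed

definition twist_covariant :: "real \<Rightarrow> real \<Rightarrow> real^'m^'m \<Rightarrow> bool" where
  "twist_covariant e c A \<longleftrightarrow> (\<forall>t.
     P t = transpose A ** P (c + e * t) ** A \<and>
     C t = e *\<^sub>R (transpose A ** C (c + e * t) ** A) \<and>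
     R t = transpose A ** R (c + e * t) ** A)"

text \<open>A twist moves the time from e (t - c) to t, and the coefficients at both times are related by the
  congruence with A. The factors e of the derivatives cancel in pairs or against the sign of C.\<close>

lemma density_twist:
  assumes e: "e \<in> {1, -1}" and cov: "twist_covariant e c A"
  shows "density (twist e c A u) (\<lambda>t. e *\<^sub>R twist e c A g t) (twist e c A v) (\<lambda>t. e *\<^sub>R twist e c A h t) t
    = density u g v h (e * (t - c))"
proof -
  define s where "s = e * (t - c)"
  have t: "c + e * s = t" using e by (auto simp: s_def)
  have ee: "complex_of_real e * complex_of_real e = 1" using e by auto
  have PCR: "P s = transpose A ** P t ** A" "C s = e *\<^sub>R (transpose A ** C t ** A)"
    "R s = transpose A ** R t ** A"
    using cov[unfolded twist_covariant_def, rule_format, of s] unfolding t by auto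
  have Ct: "transpose (C s) = e *\<^sub>R (transpose A ** transpose (C t) ** A)"
    unfolding PCR by (simp add: transpose_scalar matrix_transpose_mul matrix_mul_assoc transpose_transpose)
  have tw: "twist e c A f t = cmat A *v f s" for f by (simp add: twist_def s_def)
  have pull: "herm (cmat (transpose A ** M ** A) *v a) b = herm (cmat M *v (cmat A *v a)) (cmat A *v b)" for M a b
    by (simp add: cmat_mult matrix_vector_mul_assoc[symmetric] herm_cmat_transpose)
  have "density u g v h s = herm (cmat (P t) *v (cmat A *v g s)) (cmat A *v h s)
      + of_real e * herm (cmat (C t) *v (cmat A *v u s)) (cmat A *v h s)
      + of_real e * herm (cmat (transpose (C t)) *v (cmat A *v g s)) (cmat A *v v s)
      + herm (cmat (R t) *v (cmat A *v u s)) (cmat A *v v s)"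
    unfolding density_def cmat_transpose[symmetric] Ct unfolding PCR
    by (simp add: herm_add_left cmat_scaleR_vector herm_scale_left pull)
  moreover have "density (twist e c A u) (\<lambda>t. e *\<^sub>R twist e c A g t) (twist e c A v) (\<lambda>t. e *\<^sub>R twist e c A h t) t = \<dots>"
    unfolding density_def cmat_transpose[symmetric] tw scaleR_eq_of_real_scale
    using ee by (simp add: herm_add_left cmat_vector_scale herm_scale_left herm_scale_right distrib_left mult.assoc[symmetric])
  ultimately show ?thesis by (simp add: s_def)
qed

text \<open>The case A = Q, in which the twist fixes the elements of E. It may still replace the weak derivatives
  by others, which is why periodicity holds only almost everywhere.\<close>

lemma density_periodic:
  assumes cov: "twist_covariant 1 (- T) Q" and uE: "u \<in> E_cplx T Q" "v \<in> E_cplx T Q"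
    and u: "has_weak_deriv u g" and v: "has_weak_deriv v h"
  shows "AE t in lborel. density u g v h (t + T) = density u g v h t"
proof -
  have "twist 1 (- T) Q w = w" if "w \<in> E_cplx T Q" for w
  proof (rule ext)
    show "twist 1 (- T) Q w t = w t" for t
      using that[unfolded E_cplx_iff, THEN conjunct2, rule_format, of t] by (simp add: twist_def)
  qed
  then have fix_u: "twist 1 (- T) Q u = u" and fix_v: "twist 1 (- T) Q v = v" using uE by auto
  have "has_weak_deriv u (\<lambda>t. 1 *\<^sub>R twist 1 (- T) Q g t)" "has_weak_deriv v (\<lambda>t. 1 *\<^sub>R twist 1 (- T) Q h t)"
    using has_weak_deriv_twist[OF _ u, of 1 "- T" Q] has_weak_deriv_twist[OF _ v, of 1 "- T" Q]
    unfolding fix_u fix_v by auto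
  from has_weak_deriv_unique[OF this(1) u] has_weak_deriv_unique[OF this(2) v]
  show ?thesis
  proof eventually_elim
    case (elim t)
    have "density u g v h (t + T) =
        density u (\<lambda>t. 1 *\<^sub>R twist 1 (- T) Q g t) v (\<lambda>t. 1 *\<^sub>R twist 1 (- T) Q h t) t"
      using density_twist[OF _ cov, of u g v h t] unfolding fix_u fix_v by simp
    also have "\<dots> = density u g v h t" unfolding density_def elim ..
    finally show ?case .
  qed
qed

text \<open>Substituting e (t - c) for t leads to an integral over another interval of length T, and by
  periodicity that makes no difference.\<close>

lemma form_twist:
  assumes T: "T > 0" and e: "e \<in> {1, -1}" and cov: "twist_covariant e c A"
    and per: "twist_covariant 1 (- T) Q" and uE: "u \<in> E_cplx T Q" "v \<in> E_cplx T Q"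
  shows "form T (twist e c A u) (twist e c A v) = form T u v"
proof -
  obtain g h where u: "has_weak_deriv u g" and v: "has_weak_deriv v h"
    using uE by (auto simp: E_cplx_iff W12_loc_def)
  let ?f = "density u g v h"
  let ?a = "min (e * (0 - c)) (e * (T - c))"
  have "form T (twist e c A u) (twist e c A v) = (LBINT t:{0..T}. ?f (e * (t - c)))"
    unfolding form_eq[OF has_weak_deriv_twist[OF e u] has_weak_deriv_twist[OF e v]]
      density_twist[OF e cov] ..
  also have "\<dots> = (LBINT t:{?a..max (e * (0 - c)) (e * (T - c))}. ?f t)"
    using T by (intro set_integral_isometry(2)[OF e]) simp
  also have "max (e * (0 - c)) (e * (T - c)) = ?a + T" using e T by auto
  also have "(LBINT t:{?a..?a + T}. ?f t) = (LBINT t:{0..T}. ?f t)"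
    by (intro periodic_set_integral[OF T] density_integrable[OF u v] density_periodic[OF per uE u v])
  also have "\<dots> = form T u v" using form_eq[OF u v] by simp
  finally show ?thesis .
qed

end

section \<open>The coefficients of the index form\<close>

lemma mat_pow_0: "mat_pow A 0 = mat 1"
  by (simp add: mat_pow_def)

lemma mat_pow_Suc: "mat_pow A (Suc k) = A ** mat_pow A k"
  by (simp add: mat_pow_def)

lemma mat_pow_commute: "A ** mat_pow A k = mat_pow A k ** A"
proof (induction k)
  case (Suc k)
  then show ?case unfolding mat_pow_Suc by (metis matrix_mul_assoc)
qed (simp add: mat_pow_0)

text \<open>In particular the symmetry under S implies T-periodicity up to Q, as S^n = Q and n (T / n) = T.\<close>

lemma twist_symmetric_mat_pow:
  assumes "twist_symmetric L 1 c A"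
  shows "twist_symmetric L 1 (real k * c) (mat_pow A k)"
proof (induction k)
  case 0
  show ?case by (simp add: twist_symmetric_def mat_pow_0)
next
  case (Suc k)
  have "L t q v = L (real (Suc k) * c + 1 * t) (mat_pow A (Suc k) *v q) (1 *\<^sub>R (mat_pow A (Suc k) *v v))" for t q v
  proof -
    have "L t q v = L (real k * c + 1 * t) (mat_pow A k *v q) (1 *\<^sub>R (mat_pow A k *v v))"
      using Suc by (simp add: twist_symmetric_def)
    also have "\<dots> = L (c + 1 * (real k * c + 1 * t)) (A *v (mat_pow A k *v q)) (1 *\<^sub>R (A *v (1 *\<^sub>R (mat_pow A k *v v))))"
      using assms unfolding twist_symmetric_def by blast
    also have "c + 1 * (real k * c + 1 * t) = real (Suc k) * c + 1 * t"
      by (simp add: algebra_simps)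
    finally show ?thesis
      by (simp only: scaleR_one matrix_vector_mul_assoc mat_pow_Suc)
  qed
  then show ?case unfolding twist_symmetric_def by blast
qed

context
  fixes L :: "real \<Rightarrow> real^'m \<Rightarrow> real^'m \<Rightarrow> real" and x :: "real \<Rightarrow> real^'m"
  assumes C2: "C2 (\<lambda>(t, q, v). L t q v)" and C1: "x C1_differentiable_on UNIV"
begin

abbreviation (input) velocity where "velocity \<equiv> \<lambda>t. vector_derivative x (at t)"

abbreviation (input) "P_along \<equiv> \<lambda>t. hess_vv L t (x t) (velocity t)"
abbreviation (input) "C_along \<equiv> \<lambda>t. hess_vx L t (x t) (velocity t)"
abbreviation (input) "R_along \<equiv> \<lambda>t. hess_xx L t (x t) (velocity t)"

lemma continuous_coefficients_along: "continuous_coefficients P_along C_along R_along"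
proof -
  have x: "continuous_on UNIV x" "continuous_on UNIV velocity"
    using C1 C1_differentiable_imp_continuous_on by (auto simp: C1_differentiable_on_eq)
  show ?thesis
    by unfold_locales (intro continuous_hessians[OF C2 x])+
qed

lemma index_form_eq_form:
  "index_form L T x = continuous_coefficients.form P_along C_along R_along T"
  by (simp add: fun_eq_iff index_form_def Let_def
      continuous_coefficients.form_def[OF continuous_coefficients_along]
      continuous_coefficients.density_def[OF continuous_coefficients_along])

text \<open>A path with x (c + e t) = A x t has x' (c + e t) = e A x' t, so the symmetry of the Lagrangian maps the
  lift of the path at time t to its lift at time c + e t.\<close>

lemma twist_covariant_along:
  assumes e: "e \<in> {1, -1}" and L: "twist_symmetric L e c A" and x: "\<And>t. x (c + e * t) = A *v x t"
  shows "continuous_coefficients.twist_covariant P_along C_along R_along e c A"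
proof -
  have deriv: "(x has_vector_derivative velocity t) (at t)" for t
    using C1 by (simp add: C1_differentiable_on_eq vector_derivative_works[symmetric])
  have vel: "velocity (c + e * t) = e *\<^sub>R (A *v velocity t)" for t
  proof -
    have "((\<lambda>t. x (c + e * t)) has_vector_derivative e *\<^sub>R velocity (c + e * t)) (at t)"
    proof -
      have "((\<lambda>t. c + e * t) has_vector_derivative e) (at t)"
        by (auto intro!: derivative_eq_intros)
      from vector_diff_chain_at[OF this deriv] show ?thesis by (simp add: o_def)
    qed
    moreover have "((\<lambda>t. A *v x t) has_vector_derivative A *v velocity t) (at t)"
      using bounded_linear.has_vector_derivative[OF matrix_vector_mul_bounded_linear deriv] .
    ultimately have "e *\<^sub>R velocity (c + e * t) = A *v velocity t"
      unfolding x by (rule vector_derivative_unique_at)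
    then have "e *\<^sub>R (e *\<^sub>R velocity (c + e * t)) = e *\<^sub>R (A *v velocity t)" by simp
    then show ?thesis using e by auto
  qed
  show ?thesis
    unfolding continuous_coefficients.twist_covariant_def[OF continuous_coefficients_along] x vel
    by (intro allI conjI hessians_twist[OF C2 e L])
qed

end

lemma twist_W12_loc: "e \<in> {1, -1} \<Longrightarrow> u \<in> W12_loc \<Longrightarrow> twist e c A u \<in> W12_loc"
  using has_weak_deriv_twist[of e u] unfolding W12_loc_def by blast

lemma twist_1_E_cplx:
  assumes QA: "Q ** A = A ** Q" and u: "u \<in> E_cplx T Q"
  shows "twist 1 c A u \<in> E_cplx T Q"
proof -
  have "twist 1 c A u t = cmat Q *v twist 1 c A u (t + T)" for t
  proof -
    have "u (1 * (t - c)) = cmat Q *v u (1 * (t - c) + T)"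
      using u unfolding E_cplx_iff by blast
    then have "twist 1 c A u t = cmat A *v (cmat Q *v u (1 * (t - c) + T))"
      unfolding twist_def by (rule arg_cong)
    also have "\<dots> = cmat Q *v (cmat A *v u (1 * (t - c) + T))"
      by (simp only: matrix_vector_mul_assoc cmat_mult[symmetric] QA)
    finally show ?thesis by (simp add: twist_def algebra_simps)
  qed
  then show ?thesis
    using u[unfolded E_cplx_iff] twist_W12_loc[of 1 u c A] unfolding E_cplx_iff by blast
qed

lemma twist_minus_1_E_cplx:
  assumes QA: "Q ** A ** Q = A" and u: "u \<in> E_cplx T Q"
  shows "twist (-1) c A u \<in> E_cplx T Q"
proof -
  have "cmat Q *v twist (-1) c A u (t + T) = twist (-1) c A u t" for t
  proof -
    have "u (- (t + T - c)) = cmat Q *v u (- (t + T - c) + T)"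
      using u unfolding E_cplx_iff by blast
    then have "cmat Q *v twist (-1) c A u (t + T) = cmat Q *v (cmat A *v (cmat Q *v u (- (t + T - c) + T)))"
      by (simp add: twist_def)
    also have "\<dots> = cmat (Q ** A ** Q) *v u (- (t + T - c) + T)"
      by (simp only: matrix_vector_mul_assoc cmat_mult matrix_mul_assoc)
    also have "\<dots> = cmat A *v u (- (t + T - c) + T)" unfolding QA ..
    finally show ?thesis by (simp add: twist_def algebra_simps)
  qed
  then have "\<forall>t. twist (-1) c A u t = cmat Q *v twist (-1) c A u (t + T)" by metis
  then show ?thesis
    using u[unfolded E_cplx_iff] twist_W12_loc[of "-1" u c A] unfolding E_cplx_iff by blast
qed

lemma actS_eq_twist: "actS T n (cmat S) = twist 1 (- (T / real n)) S"
  by (simp add: actS_def twist_def fun_eq_iff)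

lemma actN_eq_twist: "actN T n (cmat N) = twist (-1) (T / real n) N"
  by (simp add: actN_def twist_def fun_eq_iff)

lemma actS_funpow: "(actS T n (cmat S) ^^ k) u = (\<lambda>t. cmat (mat_pow S k) *v u (t + real k * (T / real n)))"
proof (induction k)
  case 0
  show ?case by (simp add: mat_pow_0 cmat_one)
next
  case (Suc k)
  have arg: "t + T / real n + real k * (T / real n) = t + real (Suc k) * (T / real n)" for t
    by (simp add: algebra_simps add_divide_distrib)
  show ?case
    unfolding funpow.simps o_apply Suc.IH
    unfolding actS_def mat_pow_Suc cmat_mult matrix_vector_mul_assoc arg ..
qed

lemma subspace_E_cplx: "cfun.subspace (E_cplx T Q)"
proof -
  have sums: "u + v \<in> W12_loc" if "u \<in> W12_loc" "v \<in> W12_loc" for u v :: "real \<Rightarrow> complex^'m"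
    using that has_weak_deriv_add unfolding W12_loc_def plus_fun_def by blast
  have scales: "cscale c u \<in> W12_loc" if "u \<in> W12_loc" for c and u :: "real \<Rightarrow> complex^'m"
    using that has_weak_deriv_cscale unfolding W12_loc_def by blast
  have zero: "(0 :: real \<Rightarrow> complex^'m) \<in> W12_loc"
    unfolding W12_loc_def has_weak_deriv_def zero_fun_def
    by (auto intro!: exI[of _ "\<lambda>_. 0"] simp: set_integrable_def)
  show ?thesis
  proof (rule cfun.subspaceI)
    show "0 \<in> E_cplx T Q" using zero by (simp add: E_cplx_iff zero_fun_apply)
    show "u + v \<in> E_cplx T Q" if "u \<in> E_cplx T Q" "v \<in> E_cplx T Q" for u v
    proof -
      have per: "u t = cmat Q *v u (t + T)" "v t = cmat Q *v v (t + T)" for t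
        using that unfolding E_cplx_iff by blast+
      have "(u + v) t = cmat Q *v (u + v) (t + T)" for t
        unfolding plus_fun_apply matrix_vector_right_distrib using per[of t] by argo
      then show ?thesis using that sums unfolding E_cplx_iff by blast
    qed
    show "cscale c u \<in> E_cplx T Q" if "u \<in> E_cplx T Q" for c u
    proof -
      have "u t = cmat Q *v u (t + T)" for t using that unfolding E_cplx_iff by blast
      then have "cscale c u t = cmat Q *v cscale c u (t + T)" for t
        unfolding cscale_def cmat_vector_scale by (rule arg_cong)
      then show ?thesis using that scales unfolding E_cplx_iff by blast
    qed
  qed
qed

section \<open>Splitting the Morse index\<close>

theorem theorem2:
  fixes T :: real and n :: nat
    and Q S N :: "real^'m^'m"
    and L :: "real \<Rightarrow> real^'m \<Rightarrow> real^'m \<Rightarrow> real"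
    and x :: "real \<Rightarrow> real^'m"
  assumes "T > 0" and "n \<ge> 1"
    and "orthogonal_matrix Q" and "orthogonal_matrix S" and "orthogonal_matrix N"
    and "mat_pow S n = Q" and "N ** N = mat 1" and "S ** N = N ** transpose S"
    and "C2 (\<lambda>(t, q, v). L t q v)"
    and "legendre_convex L"
    and "\<And>t q v. L t q v = L (t - T / real n) (S *v q) (S *v v)"
    and "\<And>t q v. L t q v = L (T / real n - t) (N *v q) (- (N *v v))"
    and "critical_point L T Q x"
    and "equivariant T n S N x"
  shows "\<forall>h<n.
      morse_index (index_form L T x) (E_cplx T Q)
        = morse_index (index_form L T x) (E_refl T n Q S N h 1)
        + morse_index (index_form L T x) (E_refl T n Q S N h (-1))
    \<and> (\<forall>s\<in>{1, -1}.
         morse_index (index_form L T x) (E_refl T n Q S N h s)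
           = (\<Sum>k=0..n div 2. morse_index (index_form L T x) (F_refl T n Q S N k h s)))"
proof -
  let ?\<sigma> = "actS T n (cmat S) :: (real \<Rightarrow> complex^'m) \<Rightarrow> _"
  let ?\<nu> = "actN T n (cmat N) :: (real \<Rightarrow> complex^'m) \<Rightarrow> _"
  let ?E = "E_cplx T Q"
  let ?B = "index_form L T x"
  have n: "real n \<noteq> 0" using \<open>n \<ge> 1\<close> by simp
  have C1: "x C1_differentiable_on UNIV" and xE: "x \<in> E_real T Q"
    using \<open>critical_point L T Q x\<close> by (auto simp: critical_point_def Let_def)
  note C2 = \<open>C2 (\<lambda>(t, q, v). L t q v)\<close>

  have SNS: "S ** N ** S = N"
  proof -
    have "S ** N ** S = N ** (transpose S ** S)"
      using \<open>S ** N = N ** transpose S\<close> by (simp add: matrix_mul_assoc)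
    then show ?thesis using \<open>orthogonal_matrix S\<close> by (simp add: orthogonal_matrix_def)
  qed
  have "mat_pow S k ** N ** mat_pow S k = N" for k
  proof (induction k)
    case 0
    show ?case by (simp add: mat_pow_0)
  next
    case (Suc k)
    have "mat_pow S (Suc k) ** N ** mat_pow S (Suc k) = S ** (mat_pow S k ** N ** mat_pow S k) ** S"
      unfolding mat_pow_Suc by (subst (2) mat_pow_commute) (simp only: matrix_mul_assoc)
    then show ?case using Suc SNS by simp
  qed
  then have QNQ: "Q ** N ** Q = N" using \<open>mat_pow S n = Q\<close> by blast
  have QS: "Q ** S = S ** Q" using mat_pow_commute[of S n] \<open>mat_pow S n = Q\<close> by simp

  \<comment> \<open>The three symmetries of the Lagrangian and of the path, in the uniform notation.\<close>
  have symS: "twist_symmetric L 1 (- (T / real n)) S"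
    using assms(11) by (simp add: twist_symmetric_def)
  have symN: "twist_symmetric L (-1) (T / real n) N"
    using assms(12) by (simp add: twist_symmetric_def)
  have symQ: "twist_symmetric L 1 (- T) Q"
    using twist_symmetric_mat_pow[OF symS, of n] \<open>mat_pow S n = Q\<close> n by simp
  have Sx: "S *v x (t + T / real n) = x t" and Nx: "N *v x (T / real n - t) = x t" for t
    using \<open>equivariant T n S N x\<close> by (auto simp: equivariant_def actS_def actN_def fun_eq_iff)
  have xS: "x (- (T / real n) + 1 * t) = S *v x t" for t
    using Sx[of "t - T / real n"] by simp
  have xN: "x (T / real n + (-1) * t) = N *v x t" for t
    using Nx[of "T / real n - t"] by simp
  have xQ: "x (- T + 1 * t) = Q *v x t" for t
  proof -
    have "x (t - T) = Q *v x (t - T + T)" using xE unfolding E_real_def by blast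
    then show ?thesis by simp
  qed

  interpret coeff: continuous_coefficients
    "\<lambda>t. hess_vv L t (x t) (vector_derivative x (at t))"
    "\<lambda>t. hess_vx L t (x t) (vector_derivative x (at t))"
    "\<lambda>t. hess_xx L t (x t) (vector_derivative x (at t))"
    by (rule continuous_coefficients_along[OF C2 C1])
  have B: "?B = coeff.form T" by (rule index_form_eq_form[OF C2 C1])
  have covS: "coeff.twist_covariant 1 (- (T / real n)) S"
    by (rule twist_covariant_along[OF C2 C1 _ symS xS]) simp
  have covN: "coeff.twist_covariant (-1) (T / real n) N"
    by (rule twist_covariant_along[OF C2 C1 _ symN xN]) simp
  have covQ: "coeff.twist_covariant 1 (- T) Q"
    by (rule twist_covariant_along[OF C2 C1 _ symQ xQ]) simp

  interpret D: dihedral_form ?B ?E ?\<sigma> ?\<nu> n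
  proof
    show "cfun.subspace ?E" by (rule subspace_E_cplx)
    have W: "u \<in> W12_loc" if "u \<in> ?E" for u using that unfolding E_cplx_iff by blast
    show "?B (u + v) w = ?B u w + ?B v w" "?B w (u + v) = ?B w u + ?B w v"
      if "u \<in> ?E" "v \<in> ?E" "w \<in> ?E" for u v w
      unfolding B using that W by (auto intro: coeff.form_add_left coeff.form_add_right)
    show "?B (cscale c u) w = c * ?B u w" "?B w (cscale c u) = cnj c * ?B w u"
      if "u \<in> ?E" "w \<in> ?E" for u w c
      unfolding B using that W by (auto intro: coeff.form_scale_left coeff.form_scale_right)
    show "n \<ge> 1" by fact
    show "?\<sigma> (u + v) = ?\<sigma> u + ?\<sigma> v" "?\<nu> (u + v) = ?\<nu> u + ?\<nu> v" for u v
      by (rule ext, simp only: actS_def actN_def plus_fun_apply matrix_vector_right_distrib)+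
    show "?\<sigma> (cscale c u) = cscale c (?\<sigma> u)" "?\<nu> (cscale c u) = cscale c (?\<nu> u)" for c u
      by (simp_all add: actS_def actN_def cscale_def cmat_vector_scale)
    show "?\<sigma> u \<in> ?E" if "u \<in> ?E" for u
      unfolding actS_eq_twist by (rule twist_1_E_cplx[OF QS that])
    show "?\<nu> u \<in> ?E" if "u \<in> ?E" for u
      unfolding actN_eq_twist by (rule twist_minus_1_E_cplx[OF QNQ that])
    show "(?\<sigma> ^^ n) u = u" if "u \<in> ?E" for u
    proof (rule ext)
      fix t
      have "(?\<sigma> ^^ n) u t = cmat Q *v u (t + T)"
        unfolding actS_funpow using \<open>mat_pow S n = Q\<close> n by simp
      also have "\<dots> = u t" using that unfolding E_cplx_iff by metis
      finally show "(?\<sigma> ^^ n) u t = u t" .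
    qed
    show "?\<nu> (?\<nu> u) = u" for u
      by (simp add: actN_def matrix_vector_mul_assoc cmat_mult[symmetric] \<open>N ** N = mat 1\<close> cmat_one)
    show "?\<sigma> (?\<nu> (?\<sigma> u)) = ?\<nu> u" for u
      using SNS[folded matrix_mul_assoc]
      by (simp add: actS_def actN_def matrix_vector_mul_assoc cmat_mult[symmetric])
    show "?B (?\<sigma> u) (?\<sigma> v) = ?B u v" "?B (?\<nu> u) (?\<nu> v) = ?B u v" if "u \<in> ?E" "v \<in> ?E" for u v
      unfolding B actS_eq_twist actN_eq_twist
      using coeff.form_twist[OF \<open>T > 0\<close> _ covS covQ that] coeff.form_twist[OF \<open>T > 0\<close> _ covN covQ that]
      by simp_all
  qed

  have eig: "D.eig k = E_eig T n Q S k" for k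
    by (simp add: D.eig_def E_eig_def)
  have isotypic: "D.isotypic k = F_sp T n Q S k" for k
  proof -
    show ?thesis
    proof (cases "k = 0 \<or> 2 * k = n")
      case True
      then have "D.isotypic k = D.eig (int k)" by (intro D.isotypic_self_paired) auto
      then show ?thesis using True by (auto simp: F_sp_def eig)
    next
      case False
      then show ?thesis by (simp add: F_sp_def eig[symmetric] D.isotypic_def)
    qed
  qed
  have E_refl: "D.refl_eig ?E h s = E_refl T n Q S N h s" for h s
    by (simp add: D.refl_eig_def D.refl_def E_refl_def)
  have F_refl: "D.refl_eig (D.isotypic k) h s = F_refl T n Q S N k h s" for k h s
    by (simp add: isotypic D.refl_eig_def D.refl_def F_refl_def)
  show ?thesis
    using D.morse_index_refl_split D.morse_index_isotypic_split F_refl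
    unfolding E_refl by auto
qed

end
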